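(* Let $\mathcal K$ be either the category $\mathsf{Cat}$ of categories or the category $\mathsf{Grpd}$ of groupoids. One obtains a model structure on $\mathcal K$ by taking weak equivalences to be equivalences of categories, fibrations to be normally cloven iso-fibrations, and cofibrations to be iso-cofibrations.
   Context: $1$ is the category with one object and one arrow. $\mathcal I$ is the free groupoid on the directed graph $0\to 1$; $i_0,i_1:1\to\mathcal I$ are the functors picking out $0$ and $1$, $p:\mathcal I\to 1$ is the unique functor, and for a category $A$ we write $i_0(A):A\to A\times\mathcal I$ for $A\times i_0$. Normally cloven iso-fibration: a functor $F:A_0\to A_1$ such that to every pair $(a,g)$ with $a:1\to A_0$, $g:\mathcal I\to A_1$ and $g\circ i_0=F\circ a$ one can associate a functor $l:\mathcal I\to A_0$ with $l\circ i_0=a$ and $F\circ l=g$, in such a way that if $g=F\circ a\circ p$ then $l=a\circ p$. Iso-cofibration: a functor $j:A_0\to A_1$ in $\mathcal K$ such that for every object $A_2$ of $\mathcal K$ and all functors $g:A_1\to A_2$, $h:A_0\times\mathcal I\to A_2$ with $h\circ i_0(A_0)=g\circ j$ there is a functor $k:A_1\times\mathcal I\to A_2$ with $k\circ(j\times\mathcal I)=h$ and $k\circ i_0(A_1)=g$. A model structure means a (closed) model structure in the sense of Quillen: two-out-of-three for weak equivalences; (trivial) fibrations are exactly the arrows with the right lifting property with respect to trivial cofibrations (resp. cofibrations); (trivial) cofibrations are exactly the arrows with the left lifting property with respect to trivial fibrations (resp. fibrations); both factorisations exist (not required functorial). *)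

theory Defs
  imports Main "HOL-Library.FuncSet"
begin

record ('o, 'a) cat =
  Obj :: "'o set"
  Arr :: "'a set"
  Src :: "'a \<Rightarrow> 'o"
  Tgt :: "'a \<Rightarrow> 'o"
  Ide :: "'o \<Rightarrow> 'a"
  Comp :: "'a \<Rightarrow> 'a \<Rightarrow> 'a" (infixr "\<cdot>\<index>" 70)

text \<open>
  Composition is in applicative order: \<open>g \<cdot>\<^bsub>C\<^esub> f\<close> is meaningful when
  \<open>Tgt C f = Src C g\<close>. The values of the operations outside the carriers are irrelevant;
  records differing only there are isomorphic, as categories, via the identity on carriers.
\<close>

locale category =
  fixes C :: "('o, 'a) cat" (structure)
  assumes Src_closed: "f \<in> Arr C \<Longrightarrow> Src C f \<in> Obj C"
    and Tgt_closed: "f \<in> Arr C \<Longrightarrow> Tgt C f \<in> Obj C"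
    and Ide_closed: "x \<in> Obj C \<Longrightarrow> Ide C x \<in> Arr C"
    and Src_Ide: "x \<in> Obj C \<Longrightarrow> Src C (Ide C x) = x"
    and Tgt_Ide: "x \<in> Obj C \<Longrightarrow> Tgt C (Ide C x) = x"
    and Comp_closed: "\<lbrakk>f \<in> Arr C; g \<in> Arr C; Tgt C f = Src C g\<rbrakk> \<Longrightarrow> g \<cdot> f \<in> Arr C"
    and Src_Comp: "\<lbrakk>f \<in> Arr C; g \<in> Arr C; Tgt C f = Src C g\<rbrakk> \<Longrightarrow> Src C (g \<cdot> f) = Src C f"
    and Tgt_Comp: "\<lbrakk>f \<in> Arr C; g \<in> Arr C; Tgt C f = Src C g\<rbrakk> \<Longrightarrow> Tgt C (g \<cdot> f) = Tgt C g"
    and Comp_Ide: "f \<in> Arr C \<Longrightarrow> f \<cdot> Ide C (Src C f) = f"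
    and Ide_Comp: "f \<in> Arr C \<Longrightarrow> Ide C (Tgt C f) \<cdot> f = f"
    and Comp_assoc: "\<lbrakk>f \<in> Arr C; g \<in> Arr C; h \<in> Arr C; Tgt C f = Src C g; Tgt C g = Src C h\<rbrakk>
      \<Longrightarrow> (h \<cdot> g) \<cdot> f = h \<cdot> (g \<cdot> f)"

definition hom :: "('o, 'a) cat \<Rightarrow> 'o \<Rightarrow> 'o \<Rightarrow> 'a set" where
  "hom C x y = {f \<in> Arr C. Src C f = x \<and> Tgt C f = y}"

definition iso :: "('o, 'a) cat \<Rightarrow> 'a \<Rightarrow> bool" where
  "iso C f \<longleftrightarrow> f \<in> Arr C \<and>
     (\<exists>g \<in> hom C (Tgt C f) (Src C f).
        g \<cdot>\<^bsub>C\<^esub> f = Ide C (Src C f) \<and> f \<cdot>\<^bsub>C\<^esub> g = Ide C (Tgt C f))"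

definition groupoid :: "('o, 'a) cat \<Rightarrow> bool" where
  "groupoid C \<longleftrightarrow> category C \<and> (\<forall>f \<in> Arr C. iso C f)"

text \<open>
  A functor carries its domain and codomain, and its two maps are \<open>undefined\<close> outside the
  carriers of the domain, so that equality of these records is equality of functors.
\<close>

record ('o, 'a, 'p, 'b) cfunctor =
  FDom :: "('o, 'a) cat"
  FCod :: "('p, 'b) cat"
  FObj :: "'o \<Rightarrow> 'p"
  FArr :: "'a \<Rightarrow> 'b"

definition functors :: "('o, 'a) cat \<Rightarrow> ('p, 'b) cat \<Rightarrow> ('o, 'a, 'p, 'b) cfunctor set" where
  "functors A B = {F. FDom F = A \<and> FCod F = B \<and> category A \<and> category B \<and>
     FObj F \<in> Obj A \<rightarrow>\<^sub>E Obj B \<and> FArr F \<in> Arr A \<rightarrow>\<^sub>E Arr B \<and>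
     (\<forall>f \<in> Arr A. Src B (FArr F f) = FObj F (Src A f) \<and> Tgt B (FArr F f) = FObj F (Tgt A f)) \<and>
     (\<forall>x \<in> Obj A. FArr F (Ide A x) = Ide B (FObj F x)) \<and>
     (\<forall>f \<in> Arr A. \<forall>g \<in> Arr A. Tgt A f = Src A g \<longrightarrow>
        FArr F (g \<cdot>\<^bsub>A\<^esub> f) = FArr F g \<cdot>\<^bsub>B\<^esub> FArr F f)}"

definition id_fun :: "('o, 'a) cat \<Rightarrow> ('o, 'a, 'o, 'a) cfunctor" where
  "id_fun A = \<lparr>FDom = A, FCod = A, FObj = (\<lambda>x\<in>Obj A. x), FArr = (\<lambda>f\<in>Arr A. f)\<rparr>"

definition comp_fun ::
  "('p, 'b, 'q, 'c) cfunctor \<Rightarrow> ('o, 'a, 'p, 'b) cfunctor \<Rightarrow> ('o, 'a, 'q, 'c) cfunctor"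
  (infixr "\<circ>\<^sub>F" 70) where
  "G \<circ>\<^sub>F F = \<lparr>FDom = FDom F, FCod = FCod G,
     FObj = (\<lambda>x\<in>Obj (FDom F). FObj G (FObj F x)),
     FArr = (\<lambda>f\<in>Arr (FDom F). FArr G (FArr F f))\<rparr>"

definition nat_iso ::
  "('o, 'a, 'p, 'b) cfunctor \<Rightarrow> ('o, 'a, 'p, 'b) cfunctor \<Rightarrow> ('o \<Rightarrow> 'b) \<Rightarrow> bool" where
  "nat_iso F G \<eta> \<longleftrightarrow> FDom F = FDom G \<and> FCod F = FCod G \<and>
     (\<forall>x \<in> Obj (FDom F). \<eta> x \<in> hom (FCod F) (FObj F x) (FObj G x) \<and> iso (FCod F) (\<eta> x)) \<and>
     (\<forall>f \<in> Arr (FDom F).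
        FArr G f \<cdot>\<^bsub>FCod F\<^esub> \<eta> (Src (FDom F) f) = \<eta> (Tgt (FDom F) f) \<cdot>\<^bsub>FCod F\<^esub> FArr F f)"

definition equivalence_of_categories :: "('o, 'a, 'p, 'b) cfunctor \<Rightarrow> bool" where
  "equivalence_of_categories F \<longleftrightarrow> F \<in> functors (FDom F) (FCod F) \<and>
     (\<exists>G \<in> functors (FCod F) (FDom F).
        (\<exists>\<eta>. nat_iso (id_fun (FDom F)) (G \<circ>\<^sub>F F) \<eta>) \<and>
        (\<exists>\<epsilon>. nat_iso (F \<circ>\<^sub>F G) (id_fun (FCod F)) \<epsilon>))"

definition prod_cat :: "('o, 'a) cat \<Rightarrow> ('p, 'b) cat \<Rightarrow> ('o \<times> 'p, 'a \<times> 'b) cat"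
  (infixr "\<times>\<^sub>C" 75) where
  "A \<times>\<^sub>C B = \<lparr>Obj = Obj A \<times> Obj B, Arr = Arr A \<times> Arr B,
     Src = map_prod (Src A) (Src B), Tgt = map_prod (Tgt A) (Tgt B),
     Ide = map_prod (Ide A) (Ide B),
     Comp = (\<lambda>(g, g') (f, f'). (g \<cdot>\<^bsub>A\<^esub> f, g' \<cdot>\<^bsub>B\<^esub> f'))\<rparr>"

definition prod_fun ::
  "('o, 'a, 'p, 'b) cfunctor \<Rightarrow> ('q, 'c, 'r, 'd) cfunctor
    \<Rightarrow> ('o \<times> 'q, 'a \<times> 'c, 'p \<times> 'r, 'b \<times> 'd) cfunctor"
  (infixr "\<times>\<^sub>F" 75) where
  "F \<times>\<^sub>F G = \<lparr>FDom = FDom F \<times>\<^sub>C FDom G, FCod = FCod F \<times>\<^sub>C FCod G,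
     FObj = restrict (map_prod (FObj F) (FObj G)) (Obj (FDom F \<times>\<^sub>C FDom G)),
     FArr = restrict (map_prod (FArr F) (FArr G)) (Arr (FDom F \<times>\<^sub>C FDom G))\<rparr>"

definition one_cat :: "(unit, unit) cat" where
  "one_cat = \<lparr>Obj = UNIV, Arr = UNIV, Src = (\<lambda>_. ()), Tgt = (\<lambda>_. ()),
     Ide = (\<lambda>_. ()), Comp = (\<lambda>_ _. ())\<rparr>"

text \<open>
  The free groupoid on the graph \<open>0 \<rightarrow> 1\<close> has exactly one arrow \<open>(x, y)\<close> from \<open>x\<close> to \<open>y\<close>
  for all objects \<open>x\<close>, \<open>y\<close>; its universal property is lemma \<open>interval_free\<close> below.
\<close>

datatype endpoint = E0 | E1

definition interval :: "(endpoint, endpoint \<times> endpoint) cat" where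
  "interval = \<lparr>Obj = UNIV, Arr = UNIV, Src = fst, Tgt = snd, Ide = (\<lambda>x. (x, x)),
     Comp = (\<lambda>g f. (fst f, snd g))\<rparr>"

definition pick :: "endpoint \<Rightarrow> (unit, unit, endpoint, endpoint \<times> endpoint) cfunctor" where
  "pick e = \<lparr>FDom = one_cat, FCod = interval, FObj = (\<lambda>_. e), FArr = (\<lambda>_. (e, e))\<rparr>"

definition i0 :: "(unit, unit, endpoint, endpoint \<times> endpoint) cfunctor" where
  "i0 = pick E0"

definition collapse :: "(endpoint, endpoint \<times> endpoint, unit, unit) cfunctor" where
  "collapse = \<lparr>FDom = interval, FCod = one_cat, FObj = (\<lambda>_. ()), FArr = (\<lambda>_. ())\<rparr>"

text \<open>The functor \<open>A \<times> i\<^sub>0\<close>, with \<open>A \<times> 1\<close> identified with \<open>A\<close>.\<close>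

definition incl0 ::
  "('o, 'a) cat \<Rightarrow> ('o, 'a, 'o \<times> endpoint, 'a \<times> (endpoint \<times> endpoint)) cfunctor" where
  "incl0 A = \<lparr>FDom = A, FCod = A \<times>\<^sub>C interval,
     FObj = (\<lambda>x\<in>Obj A. (x, FObj i0 ())), FArr = (\<lambda>f\<in>Arr A. (f, FArr i0 ()))\<rparr>"

lemma category_interval: "category interval"
  by unfold_locales (auto simp: interval_def)

lemma groupoid_interval: "groupoid interval"
  unfolding groupoid_def using category_interval
  by (auto simp: iso_def hom_def interval_def)

lemma interval_free:
  fixes G :: "('o, 'a) cat"
  assumes "groupoid G" "f \<in> Arr G"
  shows "\<exists>!F. F \<in> functors interval G \<and> FArr F (E0, E1) = f"
proof -
  interpret category G using assms by (simp add: groupoid_def)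
  obtain g where g: "g \<in> hom G (Tgt G f) (Src G f)"
     "g \<cdot>\<^bsub>G\<^esub> f = Ide G (Src G f)" "f \<cdot>\<^bsub>G\<^esub> g = Ide G (Tgt G f)"
    using assms by (auto simp: groupoid_def iso_def)
  have g': "g \<in> Arr G" "Src G g = Tgt G f" "Tgt G g = Src G f" using g(1) by (auto simp: hom_def)
  define ob where "ob e = (case e of E0 \<Rightarrow> Src G f | E1 \<Rightarrow> Tgt G f)" for e
  define ar where "ar = (\<lambda>(x, y). case x of
      E0 \<Rightarrow> (case y of E0 \<Rightarrow> Ide G (Src G f) | E1 \<Rightarrow> f)
    | E1 \<Rightarrow> (case y of E0 \<Rightarrow> g | E1 \<Rightarrow> Ide G (Tgt G f)))"
  define F where "F = \<lparr>FDom = interval, FCod = G, FObj = ob, FArr = ar\<rparr>"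
  have idl: "Ide G x \<cdot>\<^bsub>G\<^esub> h = h" if "h \<in> Arr G" "Tgt G h = x" for h x using Ide_Comp that by auto
  have idr: "h \<cdot>\<^bsub>G\<^esub> Ide G x = h" if "h \<in> Arr G" "Src G h = x" for h x using Comp_Ide that by auto
  have o: "Src G f \<in> Obj G" "Tgt G f \<in> Obj G" using assms Src_closed Tgt_closed by auto
  have "F \<in> functors interval G"
    unfolding functors_def F_def using category_interval category_axioms assms o g' g
    by (auto simp: interval_def ob_def ar_def Src_Ide Tgt_Ide Ide_closed idl idr split: endpoint.splits)
  moreover have "FArr F (E0, E1) = f" by (simp add: F_def ar_def)
  moreover have "H = F" if H: "H \<in> functors interval G" "FArr H (E0, E1) = f" for H
  proof -
    have st: "Src G (FArr H (x, y)) = FObj H x" "Tgt G (FArr H (x, y)) = FObj H y"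
      and ar: "FArr H (x, y) \<in> Arr G"
      and ide: "FArr H (x, x) = Ide G (FObj H x)"
      and cmp: "FArr H (y, z) \<cdot>\<^bsub>G\<^esub> FArr H (x, y) = FArr H (x, z)" for x y z
      using H(1) by (auto simp: functors_def interval_def PiE_def Pi_def)
    have ob: "FObj H = ob"
    proof
      show "FObj H e = ob e" for e using st[of E0 E1] H(2) by (cases e) (auto simp: ob_def)
    qed
    have "FArr H (E1, E0) = (g \<cdot>\<^bsub>G\<^esub> f) \<cdot>\<^bsub>G\<^esub> FArr H (E1, E0)"
      using idl[OF ar, of E1 E0 "Src G f"] st(2)[of E1 E0] ob g(2) by (simp add: ob_def)
    also have "\<dots> = g \<cdot>\<^bsub>G\<^esub> (f \<cdot>\<^bsub>G\<^esub> FArr H (E1, E0))"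
      using Comp_assoc[OF ar[of E1 E0] assms(2) g'(1)] st(2)[of E1 E0] ob g'(2) by (simp add: ob_def)
    also have "f \<cdot>\<^bsub>G\<^esub> FArr H (E1, E0) = Ide G (Tgt G f)"
      using cmp[of E0 E1 E1] ide[of E1] ob H(2) by (simp add: ob_def)
    also have "g \<cdot>\<^bsub>G\<^esub> Ide G (Tgt G f) = g" using idr g' by simp
    finally have inv: "FArr H (E1, E0) = g" .
    have "FArr H = ar"
    proof
      show "FArr H p = ar p" for p
        using inv H(2) ide ob by (cases p) (auto simp: ar_def ob_def split: endpoint.splits)
    qed
    then show ?thesis using ob H(1) by (intro cfunctor.equality) (auto simp: F_def functors_def)
  qed
  ultimately show ?thesis by blast
qed

definition normally_cloven_isofibration :: "('o, 'a, 'p, 'b) cfunctor \<Rightarrow> bool" where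
  "normally_cloven_isofibration F \<longleftrightarrow> F \<in> functors (FDom F) (FCod F) \<and>
     (\<exists>l. \<forall>a \<in> functors one_cat (FDom F). \<forall>g \<in> functors interval (FCod F).
        g \<circ>\<^sub>F i0 = F \<circ>\<^sub>F a \<longrightarrow>
          l a g \<in> functors interval (FDom F) \<and>
          l a g \<circ>\<^sub>F i0 = a \<and> F \<circ>\<^sub>F l a g = g \<and>
          (g = F \<circ>\<^sub>F a \<circ>\<^sub>F collapse \<longrightarrow> l a g = a \<circ>\<^sub>F collapse))"

definition iso_cofibration ::
  "(('o, 'a) cat, ('o, 'a, 'o, 'a) cfunctor) cat \<Rightarrow> ('o, 'a, 'o, 'a) cfunctor \<Rightarrow> bool" where
  "iso_cofibration K j \<longleftrightarrow> j \<in> Arr K \<and>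
     (\<forall>A2 \<in> Obj K. \<forall>g \<in> functors (FCod j) A2. \<forall>h \<in> functors (FDom j \<times>\<^sub>C interval) A2.
        h \<circ>\<^sub>F incl0 (FDom j) = g \<circ>\<^sub>F j \<longrightarrow>
          (\<exists>k \<in> functors (FCod j \<times>\<^sub>C interval) A2.
             k \<circ>\<^sub>F (j \<times>\<^sub>F id_fun interval) = h \<and> k \<circ>\<^sub>F incl0 (FCod j) = g))"

text \<open>
  Smallness is relative to a universe: the small categories have objects and arrows in the
  type \<open>'u\<close>, and fewer than \<open>|\<kappa>|\<close> of each. An inaccessible \<open>|\<kappa>| \<le> |'u|\<close> gives the
  categories that are small for a Grothendieck universe; \<open>|\<kappa>| > |'u|\<close> gives all
  categories carried by \<open>'u\<close>.
\<close>

definition small_cat :: "'k set \<Rightarrow> ('u, 'u) cat \<Rightarrow> bool" where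
  "small_cat \<kappa> A \<longleftrightarrow>
     (card_of (Obj A), card_of \<kappa>) \<in> ordLess \<and> (card_of (Arr A), card_of \<kappa>) \<in> ordLess"

definition category_of_categories ::
  "('u, 'u) cat set \<Rightarrow> (('u, 'u) cat, ('u, 'u, 'u, 'u) cfunctor) cat" where
  "category_of_categories S = \<lparr>Obj = S, Arr = (\<Union>A\<in>S. \<Union>B\<in>S. functors A B),
     Src = FDom, Tgt = FCod, Ide = id_fun, Comp = comp_fun\<rparr>"

definition Cat :: "'k set \<Rightarrow> (('u, 'u) cat, ('u, 'u, 'u, 'u) cfunctor) cat" where
  "Cat \<kappa> = category_of_categories {A. category A \<and> small_cat \<kappa> A}"

definition Grpd :: "'k set \<Rightarrow> (('u, 'u) cat, ('u, 'u, 'u, 'u) cfunctor) cat" where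
  "Grpd \<kappa> = category_of_categories {A. groupoid A \<and> small_cat \<kappa> A}"

definition has_lift :: "('o, 'a) cat \<Rightarrow> 'a \<Rightarrow> 'a \<Rightarrow> bool" where
  "has_lift K i p \<longleftrightarrow>
     (\<forall>u \<in> hom K (Src K i) (Src K p). \<forall>v \<in> hom K (Tgt K i) (Tgt K p).
        p \<cdot>\<^bsub>K\<^esub> u = v \<cdot>\<^bsub>K\<^esub> i \<longrightarrow>
          (\<exists>d \<in> hom K (Tgt K i) (Src K p). d \<cdot>\<^bsub>K\<^esub> i = u \<and> p \<cdot>\<^bsub>K\<^esub> d = v))"

definition llp :: "('o, 'a) cat \<Rightarrow> 'a set \<Rightarrow> 'a set" where
  "llp K S = {i \<in> Arr K. \<forall>p \<in> S. has_lift K i p}"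

definition rlp :: "('o, 'a) cat \<Rightarrow> 'a set \<Rightarrow> 'a set" where
  "rlp K S = {p \<in> Arr K. \<forall>i \<in> S. has_lift K i p}"

definition two_out_of_three :: "('o, 'a) cat \<Rightarrow> 'a set \<Rightarrow> bool" where
  "two_out_of_three K W \<longleftrightarrow>
     (\<forall>f \<in> Arr K. \<forall>g \<in> Arr K. Tgt K f = Src K g \<longrightarrow>
        (f \<in> W \<and> g \<in> W \<longrightarrow> g \<cdot>\<^bsub>K\<^esub> f \<in> W) \<and>
        (f \<in> W \<and> g \<cdot>\<^bsub>K\<^esub> f \<in> W \<longrightarrow> g \<in> W) \<and>
        (g \<in> W \<and> g \<cdot>\<^bsub>K\<^esub> f \<in> W \<longrightarrow> f \<in> W))"

definition factorises :: "('o, 'a) cat \<Rightarrow> 'a set \<Rightarrow> 'a set \<Rightarrow> bool" where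
  "factorises K L R \<longleftrightarrow>
     (\<forall>f \<in> Arr K. \<exists>i \<in> L. \<exists>p \<in> R. Tgt K i = Src K p \<and> f = p \<cdot>\<^bsub>K\<^esub> i)"

text \<open>The arguments are the weak equivalences, the fibrations and the cofibrations.\<close>

definition model_structure ::
  "('o, 'a) cat \<Rightarrow> 'a set \<Rightarrow> 'a set \<Rightarrow> 'a set \<Rightarrow> bool" where
  "model_structure K W Fib Cof \<longleftrightarrow>
     category K \<and> W \<subseteq> Arr K \<and> Fib \<subseteq> Arr K \<and> Cof \<subseteq> Arr K \<and>
     two_out_of_three K W \<and>
     Fib = rlp K (Cof \<inter> W) \<and> Fib \<inter> W = rlp K Cof \<and>
     Cof = llp K (Fib \<inter> W) \<and> Cof \<inter> W = llp K Fib \<and>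
     factorises K (Cof \<inter> W) Fib \<and> factorises K Cof (Fib \<inter> W)"

end

theory Submission
  imports Defs
begin

text \<open>
  Both lifting conditions of the statement have elementary forms. By choice, a normally cloven
  iso-fibration is a functor \<open>F\<close> such that every isomorphism out of \<open>F x\<close> lifts to one out of
  \<open>x\<close> (\<open>normally_cloven_isofibration_iff\<close>). An iso-cofibration is a functor that is injective on
  objects: homotopies on the image extend by constant ones
  (\<open>injective_homotopy_extension\<close>), and homotopies in a chaotic category with two objects
  separate objects (\<open>injective_if_homotopy_extension\<close>). The fibrations that are equivalences
  are the fully faithful functors that are surjective on objects (\<open>trivial_fibration_iff\<close>).

  Two constructions carry the argument. A functor can be conjugated by isomorphisms chosen
  independently at each object (\<open>conj_fun\<close>), and a functor can be lifted through a fully faithful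
  one along any lift of its object map (\<open>fully_faithful_lift\<close>). The second gives the lifts of
  cofibrations against trivial fibrations. For trivial cofibrations against fibrations, a trivial
  cofibration is the inclusion of a strong deformation retract; the lift on the retract is
  conjugated by lifts of the isomorphisms of the deformation.

  For the factorisations of \<open>f : A \<rightarrow> B\<close>, both middle categories are induced: for a map from a set
  \<open>X\<close> to the objects of a category, the arrows between elements of \<open>X\<close> are the arrows between
  their images. The mapping cylinder is \<open>B\<close> induced on the disjoint union of the objects of \<open>A\<close>
  and \<open>B\<close>; the mapping path category is \<open>A\<close> induced on the pairs of an object \<open>a\<close> and an
  isomorphism out of \<open>f a\<close>. Induced categories on few objects are again small, because an infinite
  cardinal bound is closed under products, and they are groupoids over groupoids.

  The retract argument turns liftings and factorisations into the equalities between
  the classes and their lifting complements. Two-out-of-three holds because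
  equivalences are the invertible functors modulo natural isomorphism.
\<close>

section \<open>Functors and isomorphisms\<close>

lemma category_idl: "\<lbrakk>category C; f \<in> Arr C; Tgt C f = x\<rbrakk> \<Longrightarrow> Ide C x \<cdot>\<^bsub>C\<^esub> f = f"
  using category.Ide_Comp by fastforce

lemma category_idr: "\<lbrakk>category C; f \<in> Arr C; Src C f = x\<rbrakk> \<Longrightarrow> f \<cdot>\<^bsub>C\<^esub> Ide C x = f"
  using category.Comp_Ide by fastforce

lemmas category_rules = category.Src_closed category.Tgt_closed category.Ide_closed
  category.Src_Ide category.Tgt_Ide category.Comp_closed category.Src_Comp category.Tgt_Comp
  category_idl category_idr category.Comp_assoc

lemma functorsD:
  assumes "F \<in> functors A B"
  shows "FDom F = A" "FCod F = B" "category A" "category B"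
    "x \<in> Obj A \<Longrightarrow> FObj F x \<in> Obj B"
    "f \<in> Arr A \<Longrightarrow> FArr F f \<in> Arr B"
    "f \<in> Arr A \<Longrightarrow> Src B (FArr F f) = FObj F (Src A f)"
    "f \<in> Arr A \<Longrightarrow> Tgt B (FArr F f) = FObj F (Tgt A f)"
    "x \<in> Obj A \<Longrightarrow> FArr F (Ide A x) = Ide B (FObj F x)"
    "\<lbrakk>f \<in> Arr A; g \<in> Arr A; Tgt A f = Src A g\<rbrakk>
      \<Longrightarrow> FArr F (g \<cdot>\<^bsub>A\<^esub> f) = FArr F g \<cdot>\<^bsub>B\<^esub> FArr F f"
  using assms by (auto simp: functors_def)

lemma functors_extensional:
  assumes "F \<in> functors A B"
  shows "FObj F \<in> extensional (Obj A)" "FArr F \<in> extensional (Arr A)"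
  using assms by (auto simp: functors_def PiE_def)

text \<open>
  The restrictions make the record extensional, so that functors built this way can be compared
  by \<open>=\<close>.
\<close>

definition mk_functor ::
  "('o, 'a) cat \<Rightarrow> ('p, 'b) cat \<Rightarrow> ('o \<Rightarrow> 'p) \<Rightarrow> ('a \<Rightarrow> 'b) \<Rightarrow> ('o, 'a, 'p, 'b) cfunctor" where
  "mk_functor A B obj arr =
     \<lparr>FDom = A, FCod = B, FObj = restrict obj (Obj A), FArr = restrict arr (Arr A)\<rparr>"

lemma mk_functor_simps [simp]:
  "FDom (mk_functor A B obj arr) = A" "FCod (mk_functor A B obj arr) = B"
  "x \<in> Obj A \<Longrightarrow> FObj (mk_functor A B obj arr) x = obj x"
  "f \<in> Arr A \<Longrightarrow> FArr (mk_functor A B obj arr) f = arr f"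
  by (simp_all add: mk_functor_def)

lemma mk_functor:
  assumes "category A" "category B"
    and "\<And>x. x \<in> Obj A \<Longrightarrow> obj x \<in> Obj B"
    and "\<And>f. f \<in> Arr A \<Longrightarrow>
      arr f \<in> Arr B \<and> Src B (arr f) = obj (Src A f) \<and> Tgt B (arr f) = obj (Tgt A f)"
    and "\<And>x. x \<in> Obj A \<Longrightarrow> arr (Ide A x) = Ide B (obj x)"
    and "\<And>f g. \<lbrakk>f \<in> Arr A; g \<in> Arr A; Tgt A f = Src A g\<rbrakk> \<Longrightarrow> arr (g \<cdot>\<^bsub>A\<^esub> f) = arr g \<cdot>\<^bsub>B\<^esub> arr f"
  shows "mk_functor A B obj arr \<in> functors A B"
  using assms by (auto simp: functors_def mk_functor_def category_rules)

text \<open>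
  The object map is recovered from the arrow map as the source of the image of an identity,
  so only arrows have to be compared.
\<close>

lemma functor_eqI:
  assumes F: "F \<in> functors A B" and G: "G \<in> functors A B"
    and eq: "\<And>f. f \<in> Arr A \<Longrightarrow> FArr F f = FArr G f"
  shows "F = G"
proof (rule cfunctor.equality)
  note rules = functorsD[OF F] functorsD[OF G]
  have "FObj F x = FObj G x" if "x \<in> Obj A" for x
  proof -
    have "Src B (FArr F (Ide A x)) = Src B (FArr G (Ide A x))"
      using that eq by (simp add: category_rules rules(3))
    then show ?thesis using that by (simp add: rules category_rules)
  qed
  then show "FObj F = FObj G"
    using functors_extensional(1)[OF F] functors_extensional(1)[OF G] by (blast intro: extensionalityI)
  show "FArr F = FArr G"
    using functors_extensional(2)[OF F] functors_extensional(2)[OF G] eq by (blast intro: extensionalityI)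
qed (use functorsD[OF F] functorsD[OF G] in simp_all)

lemma comp_fun_simps [simp]:
  "FDom (G \<circ>\<^sub>F F) = FDom F" "FCod (G \<circ>\<^sub>F F) = FCod G"
  "x \<in> Obj (FDom F) \<Longrightarrow> FObj (G \<circ>\<^sub>F F) x = FObj G (FObj F x)"
  "f \<in> Arr (FDom F) \<Longrightarrow> FArr (G \<circ>\<^sub>F F) f = FArr G (FArr F f)"
  by (simp_all add: comp_fun_def)

lemma comp_fun:
  assumes F: "F \<in> functors A B" and G: "G \<in> functors B C"
  shows "G \<circ>\<^sub>F F \<in> functors A C"
proof -
  have "G \<circ>\<^sub>F F = mk_functor A C (\<lambda>x. FObj G (FObj F x)) (\<lambda>f. FArr G (FArr F f))"
    using functorsD[OF F] functorsD[OF G] by (simp add: comp_fun_def mk_functor_def)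
  also have "\<dots> \<in> functors A C"
    by (rule mk_functor) (simp_all add: functorsD[OF F] functorsD[OF G])
  finally show ?thesis .
qed

lemma comp_fun_assoc:
  assumes F: "F \<in> functors A B" and G: "G \<in> functors B C" and H: "H \<in> functors C D"
  shows "(H \<circ>\<^sub>F G) \<circ>\<^sub>F F = H \<circ>\<^sub>F (G \<circ>\<^sub>F F)"
  by (rule functor_eqI[OF comp_fun[OF F comp_fun[OF G H]] comp_fun[OF comp_fun[OF F G] H]])
    (simp add: functorsD[OF F] functorsD[OF G])

lemma id_fun_simps [simp]:
  "FDom (id_fun A) = A" "FCod (id_fun A) = A"
  "x \<in> Obj A \<Longrightarrow> FObj (id_fun A) x = x" "f \<in> Arr A \<Longrightarrow> FArr (id_fun A) f = f"
  by (simp_all add: id_fun_def)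

lemma id_fun: "category A \<Longrightarrow> id_fun A \<in> functors A A"
  using mk_functor[of A A "\<lambda>x. x" "\<lambda>f. f"] by (simp add: mk_functor_def id_fun_def)

lemma comp_id_fun:
  assumes F: "F \<in> functors A B"
  shows "F \<circ>\<^sub>F id_fun A = F"
  by (rule functor_eqI[OF comp_fun[OF id_fun F] F]) (simp_all add: functorsD(3)[OF F])

lemma id_comp_fun:
  assumes F: "F \<in> functors A B"
  shows "id_fun B \<circ>\<^sub>F F = F"
  by (rule functor_eqI[OF comp_fun[OF F id_fun] F]) (simp_all add: functorsD[OF F])

lemma comp_fun_eqD:
  assumes "G \<circ>\<^sub>F F = G' \<circ>\<^sub>F F'" "FDom F = A" "FDom F' = A"
  shows "x \<in> Obj A \<Longrightarrow> FObj G (FObj F x) = FObj G' (FObj F' x)"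
    "f \<in> Arr A \<Longrightarrow> FArr G (FArr F f) = FArr G' (FArr F' f)"
  using assms comp_fun_simps(3,4) by metis+

definition inv_arr :: "('o, 'a) cat \<Rightarrow> 'a \<Rightarrow> 'a" where
  "inv_arr C f = (SOME g. g \<in> hom C (Tgt C f) (Src C f) \<and>
     g \<cdot>\<^bsub>C\<^esub> f = Ide C (Src C f) \<and> f \<cdot>\<^bsub>C\<^esub> g = Ide C (Tgt C f))"

lemma inv_arr:
  assumes "iso C f"
  shows "f \<in> Arr C" "inv_arr C f \<in> Arr C"
    "Src C (inv_arr C f) = Tgt C f" "Tgt C (inv_arr C f) = Src C f"
    "inv_arr C f \<cdot>\<^bsub>C\<^esub> f = Ide C (Src C f)" "f \<cdot>\<^bsub>C\<^esub> inv_arr C f = Ide C (Tgt C f)"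
proof -
  have "\<exists>g. g \<in> hom C (Tgt C f) (Src C f) \<and>
     g \<cdot>\<^bsub>C\<^esub> f = Ide C (Src C f) \<and> f \<cdot>\<^bsub>C\<^esub> g = Ide C (Tgt C f)"
    using assms by (auto simp: iso_def)
  from someI_ex[OF this] show "inv_arr C f \<in> Arr C"
    "Src C (inv_arr C f) = Tgt C f" "Tgt C (inv_arr C f) = Src C f"
    "inv_arr C f \<cdot>\<^bsub>C\<^esub> f = Ide C (Src C f)" "f \<cdot>\<^bsub>C\<^esub> inv_arr C f = Ide C (Tgt C f)"
    by (auto simp: inv_arr_def hom_def)
  show "f \<in> Arr C" using assms by (simp add: iso_def)
qed

lemma inv_arr_cancel:
  assumes "category C" "iso C f" "h \<in> Arr C"
  shows "Tgt C h = Src C f \<Longrightarrow> inv_arr C f \<cdot>\<^bsub>C\<^esub> (f \<cdot>\<^bsub>C\<^esub> h) = h"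
    and "Tgt C h = Tgt C f \<Longrightarrow> f \<cdot>\<^bsub>C\<^esub> (inv_arr C f \<cdot>\<^bsub>C\<^esub> h) = h"
  using assms by (simp_all add: category.Comp_assoc[symmetric] inv_arr category_idl)

lemma isoI:
  "\<lbrakk>f \<in> Arr C; g \<in> Arr C; Src C g = Tgt C f; Tgt C g = Src C f;
    g \<cdot>\<^bsub>C\<^esub> f = Ide C (Src C f); f \<cdot>\<^bsub>C\<^esub> g = Ide C (Tgt C f)\<rbrakk> \<Longrightarrow> iso C f"
  by (auto simp: iso_def hom_def)

lemma inv_arr_eqI:
  assumes "category C" "iso C f" "g \<in> Arr C" "Src C g = Tgt C f" "Tgt C g = Src C f"
    "g \<cdot>\<^bsub>C\<^esub> f = Ide C (Src C f)"
  shows "inv_arr C f = g"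
proof -
  have "g = (g \<cdot>\<^bsub>C\<^esub> f) \<cdot>\<^bsub>C\<^esub> inv_arr C f"
    using assms(1-5) by (simp add: category_rules inv_arr)
  also have "\<dots> = inv_arr C f"
    using assms(1,2,6) by (simp add: category_rules inv_arr)
  finally show ?thesis by simp
qed

lemma iso_inv_arr: "category C \<Longrightarrow> iso C f \<Longrightarrow> iso C (inv_arr C f)"
  by (rule isoI[of _ _ f]) (auto simp: inv_arr)

lemma inv_arr_inv_arr: "category C \<Longrightarrow> iso C f \<Longrightarrow> inv_arr C (inv_arr C f) = f"
  by (rule inv_arr_eqI) (auto simp: inv_arr iso_inv_arr)

lemma iso_Ide: "category C \<Longrightarrow> x \<in> Obj C \<Longrightarrow> iso C (Ide C x)"
  by (rule isoI[of _ _ "Ide C x"]) (auto simp: category_rules)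

lemma inv_arr_Ide: "category C \<Longrightarrow> x \<in> Obj C \<Longrightarrow> inv_arr C (Ide C x) = Ide C x"
  by (rule inv_arr_eqI) (auto simp: category_rules iso_Ide)

lemma iso_Comp:
  assumes "category C" "iso C f" "iso C g" "Tgt C f = Src C g"
  shows "iso C (g \<cdot>\<^bsub>C\<^esub> f)"
  using assms by (intro isoI[of _ _ "inv_arr C f \<cdot>\<^bsub>C\<^esub> inv_arr C g"])
    (simp_all add: category_rules inv_arr inv_arr_cancel)

lemma functor_iso:
  assumes F: "F \<in> functors A B" and f: "iso A f"
  shows "iso B (FArr F f)" "FArr F (inv_arr A f) = inv_arr B (FArr F f)"
proof -
  note inv = inv_arr[OF f]
  have 1: "FArr F (inv_arr A f) \<cdot>\<^bsub>B\<^esub> FArr F f = Ide B (FObj F (Src A f))"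
    unfolding functorsD(10)[OF F inv(1,2) inv(3)[symmetric], symmetric] inv(5)
    using inv(1) by (simp add: functorsD[OF F] category_rules)
  have 2: "FArr F f \<cdot>\<^bsub>B\<^esub> FArr F (inv_arr A f) = Ide B (FObj F (Tgt A f))"
    unfolding functorsD(10)[OF F inv(2,1) inv(4), symmetric] inv(6)
    using inv(1) by (simp add: functorsD[OF F] category_rules)
  show iso: "iso B (FArr F f)"
    by (rule isoI[of _ _ "FArr F (inv_arr A f)"]) (simp_all add: 1 2 inv functorsD[OF F])
  show "FArr F (inv_arr A f) = inv_arr B (FArr F f)"
    by (rule inv_arr_eqI[symmetric, OF _ iso]) (simp_all add: 1 inv functorsD[OF F])
qed

section \<open>Functors up to natural isomorphism\<close>

text \<open>
  Natural isomorphism is a congruence for composition, and equivalences are the functors that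
  are invertible modulo this congruence. Two-out-of-three is then the corresponding fact about
  invertible arrows.
\<close>

definition isomorphic_functors ::
  "('o, 'a, 'p, 'b) cfunctor \<Rightarrow> ('o, 'a, 'p, 'b) cfunctor \<Rightarrow> bool" (infix "\<cong>\<^sub>F" 50) where
  "F \<cong>\<^sub>F G \<longleftrightarrow> F \<in> functors (FDom F) (FCod F) \<and> G \<in> functors (FDom F) (FCod F) \<and>
     (\<exists>\<eta>. nat_iso F G \<eta>)"

lemma isomorphic_functorsI:
  assumes F: "F \<in> functors A B" and G: "G \<in> functors A B"
    and comp: "\<And>x. x \<in> Obj A \<Longrightarrow> iso B (\<eta> x) \<and> Src B (\<eta> x) = FObj F x \<and> Tgt B (\<eta> x) = FObj G x"
    and nat: "\<And>f. f \<in> Arr A \<Longrightarrow> FArr G f \<cdot>\<^bsub>B\<^esub> \<eta> (Src A f) = \<eta> (Tgt A f) \<cdot>\<^bsub>B\<^esub> FArr F f"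
  shows "F \<cong>\<^sub>F G"
  unfolding isomorphic_functors_def nat_iso_def
  using F G comp nat
  by (auto intro!: exI[of _ \<eta>] simp: functorsD[OF F] functorsD[OF G] hom_def inv_arr)

lemma isomorphic_functorsE:
  assumes "F \<cong>\<^sub>F G" and F: "F \<in> functors A B"
  obtains \<eta> where "G \<in> functors A B"
    "\<And>x. x \<in> Obj A \<Longrightarrow> iso B (\<eta> x)"
    "\<And>x. x \<in> Obj A \<Longrightarrow> Src B (\<eta> x) = FObj F x"
    "\<And>x. x \<in> Obj A \<Longrightarrow> Tgt B (\<eta> x) = FObj G x"
    "\<And>f. f \<in> Arr A \<Longrightarrow> FArr G f \<cdot>\<^bsub>B\<^esub> \<eta> (Src A f) = \<eta> (Tgt A f) \<cdot>\<^bsub>B\<^esub> FArr F f"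
  using assms functorsD(1,2)[OF F]
  by (auto simp: isomorphic_functors_def nat_iso_def hom_def)

lemma isomorphic_functors_sym:
  assumes "F \<cong>\<^sub>F G"
  shows "G \<cong>\<^sub>F F"
proof -
  define A B where "A = FDom F" and "B = FCod F"
  have F: "F \<in> functors A B" using assms by (simp add: isomorphic_functors_def A_def B_def)
  obtain \<eta> where \<eta>: "G \<in> functors A B"
    "\<And>x. x \<in> Obj A \<Longrightarrow> iso B (\<eta> x)"
    "\<And>x. x \<in> Obj A \<Longrightarrow> Src B (\<eta> x) = FObj F x"
    "\<And>x. x \<in> Obj A \<Longrightarrow> Tgt B (\<eta> x) = FObj G x"
    "\<And>f. f \<in> Arr A \<Longrightarrow> FArr G f \<cdot>\<^bsub>B\<^esub> \<eta> (Src A f) = \<eta> (Tgt A f) \<cdot>\<^bsub>B\<^esub> FArr F f"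
    using isomorphic_functorsE[OF assms F] by blast
  note cA = functorsD(3)[OF F] and cB = functorsD(4)[OF F]
  show ?thesis
  proof (rule isomorphic_functorsI[OF \<eta>(1) F, of "\<lambda>x. inv_arr B (\<eta> x)"])
    fix f assume f: "f \<in> Arr A"
    have st: "Src A f \<in> Obj A" "Tgt A f \<in> Obj A" using f cA by (auto simp: category_rules)
    note rules = \<eta>(2-4) f st cA cB category_rules functorsD[OF F] functorsD[OF \<eta>(1)] inv_arr
      inv_arr_cancel
    have "inv_arr B (\<eta> (Tgt A f)) \<cdot>\<^bsub>B\<^esub> ((FArr G f \<cdot>\<^bsub>B\<^esub> \<eta> (Src A f)) \<cdot>\<^bsub>B\<^esub> inv_arr B (\<eta> (Src A f)))
      = FArr F f \<cdot>\<^bsub>B\<^esub> inv_arr B (\<eta> (Src A f))"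
      unfolding \<eta>(5)[OF f] by (simp add: rules)
    then show "FArr F f \<cdot>\<^bsub>B\<^esub> inv_arr B (\<eta> (Src A f)) = inv_arr B (\<eta> (Tgt A f)) \<cdot>\<^bsub>B\<^esub> FArr G f"
      by (simp add: rules)
  qed (simp_all add: inv_arr \<eta>(2-4) iso_inv_arr cB)
qed

lemma isomorphic_functors_trans [trans]:
  assumes "F \<cong>\<^sub>F G" "G \<cong>\<^sub>F H"
  shows "F \<cong>\<^sub>F H"
proof -
  define A B where "A = FDom F" and "B = FCod F"
  have F: "F \<in> functors A B" using assms by (simp add: isomorphic_functors_def A_def B_def)
  obtain \<eta> where \<eta>: "G \<in> functors A B"
    "\<And>x. x \<in> Obj A \<Longrightarrow> iso B (\<eta> x)"
    "\<And>x. x \<in> Obj A \<Longrightarrow> Src B (\<eta> x) = FObj F x"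
    "\<And>x. x \<in> Obj A \<Longrightarrow> Tgt B (\<eta> x) = FObj G x"
    "\<And>f. f \<in> Arr A \<Longrightarrow> FArr G f \<cdot>\<^bsub>B\<^esub> \<eta> (Src A f) = \<eta> (Tgt A f) \<cdot>\<^bsub>B\<^esub> FArr F f"
    using isomorphic_functorsE[OF assms(1) F] by blast
  obtain \<theta> where \<theta>: "H \<in> functors A B"
    "\<And>x. x \<in> Obj A \<Longrightarrow> iso B (\<theta> x)"
    "\<And>x. x \<in> Obj A \<Longrightarrow> Src B (\<theta> x) = FObj G x"
    "\<And>x. x \<in> Obj A \<Longrightarrow> Tgt B (\<theta> x) = FObj H x"
    "\<And>f. f \<in> Arr A \<Longrightarrow> FArr H f \<cdot>\<^bsub>B\<^esub> \<theta> (Src A f) = \<theta> (Tgt A f) \<cdot>\<^bsub>B\<^esub> FArr G f"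
    using isomorphic_functorsE[OF assms(2) \<eta>(1)] by blast
  note cA = functorsD(3)[OF F] and cB = functorsD(4)[OF F]
  show ?thesis
  proof (rule isomorphic_functorsI[OF F \<theta>(1), of "\<lambda>x. \<theta> x \<cdot>\<^bsub>B\<^esub> \<eta> x"])
    fix f assume f: "f \<in> Arr A"
    have st: "Src A f \<in> Obj A" "Tgt A f \<in> Obj A" using f cA by (auto simp: category_rules)
    note rules = \<eta>(2-4) \<theta>(2-4) f st cA cB functorsD[OF F] functorsD[OF \<eta>(1)]
      functorsD[OF \<theta>(1)] inv_arr category_rules(1-10)
    have "FArr H f \<cdot>\<^bsub>B\<^esub> \<theta> (Src A f) \<cdot>\<^bsub>B\<^esub> \<eta> (Src A f)
      = (FArr H f \<cdot>\<^bsub>B\<^esub> \<theta> (Src A f)) \<cdot>\<^bsub>B\<^esub> \<eta> (Src A f)"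
      by (rule category.Comp_assoc[symmetric]) (simp_all add: rules)
    also have "\<dots> = \<theta> (Tgt A f) \<cdot>\<^bsub>B\<^esub> (FArr G f \<cdot>\<^bsub>B\<^esub> \<eta> (Src A f))"
      unfolding \<theta>(5)[OF f] by (rule category.Comp_assoc) (simp_all add: rules)
    also have "\<dots> = (\<theta> (Tgt A f) \<cdot>\<^bsub>B\<^esub> \<eta> (Tgt A f)) \<cdot>\<^bsub>B\<^esub> FArr F f"
      unfolding \<eta>(5)[OF f] by (rule category.Comp_assoc[symmetric]) (simp_all add: rules)
    finally show "FArr H f \<cdot>\<^bsub>B\<^esub> \<theta> (Src A f) \<cdot>\<^bsub>B\<^esub> \<eta> (Src A f)
      = (\<theta> (Tgt A f) \<cdot>\<^bsub>B\<^esub> \<eta> (Tgt A f)) \<cdot>\<^bsub>B\<^esub> FArr F f" .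
  qed (simp_all add: inv_arr \<eta>(2-4) \<theta>(2-4) iso_Comp cB category_rules)
qed

lemma isomorphic_functors_whisker_left:
  assumes iso: "F \<cong>\<^sub>F G" and F: "F \<in> functors A B" and H: "H \<in> functors B C"
  shows "H \<circ>\<^sub>F F \<cong>\<^sub>F H \<circ>\<^sub>F G"
proof -
  obtain \<eta> where \<eta>: "G \<in> functors A B"
    "\<And>x. x \<in> Obj A \<Longrightarrow> iso B (\<eta> x)"
    "\<And>x. x \<in> Obj A \<Longrightarrow> Src B (\<eta> x) = FObj F x"
    "\<And>x. x \<in> Obj A \<Longrightarrow> Tgt B (\<eta> x) = FObj G x"
    "\<And>f. f \<in> Arr A \<Longrightarrow> FArr G f \<cdot>\<^bsub>B\<^esub> \<eta> (Src A f) = \<eta> (Tgt A f) \<cdot>\<^bsub>B\<^esub> FArr F f"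
    using isomorphic_functorsE[OF iso F] by blast
  show ?thesis
  proof (rule isomorphic_functorsI[OF comp_fun[OF F H] comp_fun[OF \<eta>(1) H], of "\<lambda>x. FArr H (\<eta> x)"])
    fix f assume f: "f \<in> Arr A"
    have st: "Src A f \<in> Obj A" "Tgt A f \<in> Obj A"
      using f functorsD(3)[OF F] by (auto simp: category_rules)
    show "FArr (H \<circ>\<^sub>F G) f \<cdot>\<^bsub>C\<^esub> FArr H (\<eta> (Src A f)) = FArr H (\<eta> (Tgt A f)) \<cdot>\<^bsub>C\<^esub> FArr (H \<circ>\<^sub>F F) f"
      using arg_cong[OF \<eta>(5)[OF f], of "FArr H"] f st
      by (simp add: functorsD[OF F] functorsD[OF H] functorsD[OF \<eta>(1)] \<eta>(2-4) inv_arr)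
  qed (simp_all add: functorsD[OF F] functorsD[OF H] functorsD[OF \<eta>(1)] \<eta>(2-4) inv_arr functor_iso(1)[OF H])
qed

lemma isomorphic_functors_whisker_right:
  assumes iso: "F \<cong>\<^sub>F G" and F: "F \<in> functors A B" and H: "H \<in> functors Z A"
  shows "F \<circ>\<^sub>F H \<cong>\<^sub>F G \<circ>\<^sub>F H"
proof -
  obtain \<eta> where \<eta>: "G \<in> functors A B"
    "\<And>x. x \<in> Obj A \<Longrightarrow> iso B (\<eta> x)"
    "\<And>x. x \<in> Obj A \<Longrightarrow> Src B (\<eta> x) = FObj F x"
    "\<And>x. x \<in> Obj A \<Longrightarrow> Tgt B (\<eta> x) = FObj G x"
    "\<And>f. f \<in> Arr A \<Longrightarrow> FArr G f \<cdot>\<^bsub>B\<^esub> \<eta> (Src A f) = \<eta> (Tgt A f) \<cdot>\<^bsub>B\<^esub> FArr F f"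
    using isomorphic_functorsE[OF iso F] by blast
  show ?thesis
  proof (rule isomorphic_functorsI[OF comp_fun[OF H F] comp_fun[OF H \<eta>(1)], of "\<lambda>x. \<eta> (FObj H x)"])
    fix f assume f: "f \<in> Arr Z"
    show "FArr (G \<circ>\<^sub>F H) f \<cdot>\<^bsub>B\<^esub> \<eta> (FObj H (Src Z f)) = \<eta> (FObj H (Tgt Z f)) \<cdot>\<^bsub>B\<^esub> FArr (F \<circ>\<^sub>F H) f"
      using f \<eta>(5)[of "FArr H f"] by (simp add: functorsD[OF H])
  qed (simp_all add: functorsD[OF H] \<eta>(2-4))
qed

lemma equivalence_iff:
  assumes F: "F \<in> functors A B"
  shows "equivalence_of_categories F \<longleftrightarrow>
    (\<exists>G \<in> functors B A. G \<circ>\<^sub>F F \<cong>\<^sub>F id_fun A \<and> F \<circ>\<^sub>F G \<cong>\<^sub>F id_fun B)"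
proof -
  have "(\<exists>\<eta>. nat_iso (id_fun A) (G \<circ>\<^sub>F F) \<eta>) \<longleftrightarrow> G \<circ>\<^sub>F F \<cong>\<^sub>F id_fun A"
    "(\<exists>\<epsilon>. nat_iso (F \<circ>\<^sub>F G) (id_fun B) \<epsilon>) \<longleftrightarrow> F \<circ>\<^sub>F G \<cong>\<^sub>F id_fun B"
    if G: "G \<in> functors B A" for G
  proof -
    have ids: "id_fun A \<in> functors A A" "id_fun B \<in> functors B B"
      using functorsD(3,4)[OF F] by (simp_all add: id_fun)
    have "id_fun A \<cong>\<^sub>F G \<circ>\<^sub>F F \<longleftrightarrow> (\<exists>\<eta>. nat_iso (id_fun A) (G \<circ>\<^sub>F F) \<eta>)"
      using ids comp_fun[OF F G] by (simp add: isomorphic_functors_def)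
    then show "(\<exists>\<eta>. nat_iso (id_fun A) (G \<circ>\<^sub>F F) \<eta>) \<longleftrightarrow> G \<circ>\<^sub>F F \<cong>\<^sub>F id_fun A"
      using isomorphic_functors_sym by blast
    show "(\<exists>\<epsilon>. nat_iso (F \<circ>\<^sub>F G) (id_fun B) \<epsilon>) \<longleftrightarrow> F \<circ>\<^sub>F G \<cong>\<^sub>F id_fun B"
      using ids comp_fun[OF G F] by (simp add: isomorphic_functors_def functorsD[OF F] functorsD[OF G])
  qed
  then show ?thesis
    using F by (auto simp: equivalence_of_categories_def functorsD(1,2)[OF F])
qed

text \<open>
  The only computation in two-out-of-three: a pair of mutually inverse functors disappears from
  the middle of a composite.
\<close>

lemma isomorphic_functors_cancel_middle:
  assumes S: "S \<in> functors A B" and R: "R \<in> functors B C"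
    and Q: "Q \<in> functors C B" and P: "P \<in> functors B D"
    and QR: "Q \<circ>\<^sub>F R \<cong>\<^sub>F id_fun B"
  shows "(P \<circ>\<^sub>F Q) \<circ>\<^sub>F (R \<circ>\<^sub>F S) \<cong>\<^sub>F P \<circ>\<^sub>F S"
proof -
  have "(P \<circ>\<^sub>F Q) \<circ>\<^sub>F (R \<circ>\<^sub>F S) = P \<circ>\<^sub>F ((Q \<circ>\<^sub>F R) \<circ>\<^sub>F S)"
    by (simp add: comp_fun_assoc[OF S R Q] comp_fun_assoc[OF comp_fun[OF S R] Q P])
  also have "\<dots> \<cong>\<^sub>F P \<circ>\<^sub>F (id_fun B \<circ>\<^sub>F S)"
    by (rule isomorphic_functors_whisker_left[OF _ comp_fun[OF S comp_fun[OF R Q]] P])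
      (rule isomorphic_functors_whisker_right[OF QR comp_fun[OF R Q] S])
  finally show ?thesis by (simp add: id_comp_fun[OF S])
qed

lemma equivalenceE:
  assumes "equivalence_of_categories F" "F \<in> functors A B"
  obtains G where "G \<in> functors B A" "G \<circ>\<^sub>F F \<cong>\<^sub>F id_fun A" "F \<circ>\<^sub>F G \<cong>\<^sub>F id_fun B"
  using assms equivalence_iff by blast

lemma equivalenceI:
  assumes "F \<in> functors A B" "G \<in> functors B A" "G \<circ>\<^sub>F F \<cong>\<^sub>F id_fun A" "F \<circ>\<^sub>F G \<cong>\<^sub>F id_fun B"
  shows "equivalence_of_categories F"
  using assms equivalence_iff by blast

lemma equivalence_comp:
  assumes F: "F \<in> functors A B" and G: "G \<in> functors B C"
    and eqF: "equivalence_of_categories F" and eqG: "equivalence_of_categories G"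
  shows "equivalence_of_categories (G \<circ>\<^sub>F F)"
proof -
  obtain F' where F': "F' \<in> functors B A" "F' \<circ>\<^sub>F F \<cong>\<^sub>F id_fun A" "F \<circ>\<^sub>F F' \<cong>\<^sub>F id_fun B"
    using equivalenceE[OF eqF F] .
  obtain G' where G': "G' \<in> functors C B" "G' \<circ>\<^sub>F G \<cong>\<^sub>F id_fun B" "G \<circ>\<^sub>F G' \<cong>\<^sub>F id_fun C"
    using equivalenceE[OF eqG G] .
  show ?thesis
  proof (rule equivalenceI[OF comp_fun[OF F G] comp_fun[OF G'(1) F'(1)]])
    show "(F' \<circ>\<^sub>F G') \<circ>\<^sub>F (G \<circ>\<^sub>F F) \<cong>\<^sub>F id_fun A"
      using isomorphic_functors_cancel_middle[OF F G G'(1) F'(1) G'(2)] F'(2)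
      by (rule isomorphic_functors_trans)
    show "(G \<circ>\<^sub>F F) \<circ>\<^sub>F (F' \<circ>\<^sub>F G') \<cong>\<^sub>F id_fun C"
      using isomorphic_functors_cancel_middle[OF G'(1) F'(1) F G F'(3)] G'(3)
      by (rule isomorphic_functors_trans)
  qed
qed

text \<open>
  With \<open>H = G F\<close> and quasi-inverses \<open>F'\<close>, \<open>H'\<close>, the quasi-inverse of \<open>G\<close> is \<open>F H'\<close>: since
  \<open>G \<cong> H F'\<close>, the composite \<open>F H' G\<close> is isomorphic to \<open>F H' H F'\<close>, hence to \<open>F F'\<close>.
\<close>

lemma equivalence_cancel_right:
  assumes F: "F \<in> functors A B" and G: "G \<in> functors B C"
    and eqF: "equivalence_of_categories F" and eqGF: "equivalence_of_categories (G \<circ>\<^sub>F F)"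
  shows "equivalence_of_categories G"
proof -
  define H where "H = G \<circ>\<^sub>F F"
  have H: "H \<in> functors A C" using comp_fun[OF F G] by (simp add: H_def)
  obtain F' where F': "F' \<in> functors B A" "F' \<circ>\<^sub>F F \<cong>\<^sub>F id_fun A" "F \<circ>\<^sub>F F' \<cong>\<^sub>F id_fun B"
    using equivalenceE[OF eqF F] .
  obtain H' where H': "H' \<in> functors C A" "H' \<circ>\<^sub>F H \<cong>\<^sub>F id_fun A" "H \<circ>\<^sub>F H' \<cong>\<^sub>F id_fun C"
    using equivalenceE[OF eqGF[folded H_def] H] .
  show ?thesis
  proof (rule equivalenceI[OF G comp_fun[OF H'(1) F]])
    show "G \<circ>\<^sub>F (F \<circ>\<^sub>F H') \<cong>\<^sub>F id_fun C"
      using H'(3) by (simp add: H_def comp_fun_assoc[OF H'(1) F G])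
    have "H \<circ>\<^sub>F F' \<cong>\<^sub>F G"
      using isomorphic_functors_whisker_left[OF F'(3) comp_fun[OF F'(1) F] G]
      by (simp add: H_def comp_fun_assoc[OF F'(1) F G] comp_id_fun[OF G])
    from isomorphic_functors_whisker_left[OF this comp_fun[OF F'(1) H] comp_fun[OF H'(1) F]]
    have "(F \<circ>\<^sub>F H') \<circ>\<^sub>F G \<cong>\<^sub>F (F \<circ>\<^sub>F H') \<circ>\<^sub>F (H \<circ>\<^sub>F F')"
      by (rule isomorphic_functors_sym)
    also have "\<dots> \<cong>\<^sub>F F \<circ>\<^sub>F F'"
      by (rule isomorphic_functors_cancel_middle[OF F'(1) H H'(1) F H'(2)])
    also note F'(3)
    finally show "(F \<circ>\<^sub>F H') \<circ>\<^sub>F G \<cong>\<^sub>F id_fun B" .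
  qed
qed

text \<open>
  Dually, the quasi-inverse of \<open>F\<close> is \<open>H' G\<close>, because \<open>F \<cong> G' H\<close>.
\<close>

lemma equivalence_cancel_left:
  assumes F: "F \<in> functors A B" and G: "G \<in> functors B C"
    and eqG: "equivalence_of_categories G" and eqGF: "equivalence_of_categories (G \<circ>\<^sub>F F)"
  shows "equivalence_of_categories F"
proof -
  define H where "H = G \<circ>\<^sub>F F"
  have H: "H \<in> functors A C" using comp_fun[OF F G] by (simp add: H_def)
  obtain G' where G': "G' \<in> functors C B" "G' \<circ>\<^sub>F G \<cong>\<^sub>F id_fun B" "G \<circ>\<^sub>F G' \<cong>\<^sub>F id_fun C"
    using equivalenceE[OF eqG G] .
  obtain H' where H': "H' \<in> functors C A" "H' \<circ>\<^sub>F H \<cong>\<^sub>F id_fun A" "H \<circ>\<^sub>F H' \<cong>\<^sub>F id_fun C"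
    using equivalenceE[OF eqGF[folded H_def] H] .
  show ?thesis
  proof (rule equivalenceI[OF F comp_fun[OF G H'(1)]])
    show "(H' \<circ>\<^sub>F G) \<circ>\<^sub>F F \<cong>\<^sub>F id_fun A"
      using H'(2) by (simp add: H_def comp_fun_assoc[OF F G H'(1)])
    have "G' \<circ>\<^sub>F H \<cong>\<^sub>F F"
      using isomorphic_functors_whisker_right[OF G'(2) comp_fun[OF G G'(1)] F]
      by (simp add: H_def comp_fun_assoc[OF F G G'(1)] id_comp_fun[OF F])
    from isomorphic_functors_whisker_right[OF this comp_fun[OF H G'(1)] comp_fun[OF G H'(1)]]
    have "F \<circ>\<^sub>F (H' \<circ>\<^sub>F G) \<cong>\<^sub>F (G' \<circ>\<^sub>F H) \<circ>\<^sub>F (H' \<circ>\<^sub>F G)"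
      by (rule isomorphic_functors_sym)
    also have "\<dots> \<cong>\<^sub>F G' \<circ>\<^sub>F G"
      by (rule isomorphic_functors_cancel_middle[OF G H'(1) H G'(1) H'(3)])
    also note G'(2)
    finally show "F \<circ>\<^sub>F (H' \<circ>\<^sub>F G) \<cong>\<^sub>F id_fun B" .
  qed
qed

section \<open>Fully faithful functors and conjugation\<close>

definition fully_faithful :: "('o, 'a, 'p, 'b) cfunctor \<Rightarrow> bool" where
  "fully_faithful F \<longleftrightarrow> (\<forall>x \<in> Obj (FDom F). \<forall>y \<in> Obj (FDom F).
     bij_betw (FArr F) (hom (FDom F) x y) (hom (FCod F) (FObj F x) (FObj F y)))"

definition essentially_surjective :: "('o, 'a, 'p, 'b) cfunctor \<Rightarrow> bool" where
  "essentially_surjective F \<longleftrightarrow> (\<forall>b \<in> Obj (FCod F). \<exists>a \<in> Obj (FDom F). \<exists>\<phi>.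
     iso (FCod F) \<phi> \<and> Src (FCod F) \<phi> = FObj F a \<and> Tgt (FCod F) \<phi> = b)"

lemma fully_faithfulI:
  assumes F: "F \<in> functors A B"
    and faithful: "\<And>f g. \<lbrakk>f \<in> Arr A; g \<in> Arr A; Src A f = Src A g; Tgt A f = Tgt A g;
      FArr F f = FArr F g\<rbrakk> \<Longrightarrow> f = g"
    and full: "\<And>x y \<beta>. \<lbrakk>x \<in> Obj A; y \<in> Obj A; \<beta> \<in> Arr B; Src B \<beta> = FObj F x;
      Tgt B \<beta> = FObj F y\<rbrakk> \<Longrightarrow> \<exists>f \<in> Arr A. Src A f = x \<and> Tgt A f = y \<and> FArr F f = \<beta>"
  shows "fully_faithful F"
  unfolding fully_faithful_def functorsD(1,2)[OF F]
proof (intro ballI bij_betw_imageI)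
  fix x y assume xy: "x \<in> Obj A" "y \<in> Obj A"
  show "inj_on (FArr F) (hom A x y)"
    using faithful by (auto simp: inj_on_def hom_def)
  show "FArr F ` hom A x y = hom B (FObj F x) (FObj F y)"
  proof
    show "FArr F ` hom A x y \<subseteq> hom B (FObj F x) (FObj F y)"
      by (auto simp: hom_def functorsD[OF F])
    show "hom B (FObj F x) (FObj F y) \<subseteq> FArr F ` hom A x y"
      using full[OF xy] by (fastforce simp: hom_def)
  qed
qed

lemma fully_faithfulD:
  assumes "fully_faithful F" and F: "F \<in> functors A B"
  shows faithfulD: "\<lbrakk>f \<in> Arr A; g \<in> Arr A; Src A f = Src A g; Tgt A f = Tgt A g;
      FArr F f = FArr F g\<rbrakk> \<Longrightarrow> f = g"
    and fullD: "\<lbrakk>x \<in> Obj A; y \<in> Obj A; \<beta> \<in> Arr B; Src B \<beta> = FObj F x;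
      Tgt B \<beta> = FObj F y\<rbrakk> \<Longrightarrow> \<exists>f \<in> Arr A. Src A f = x \<and> Tgt A f = y \<and> FArr F f = \<beta>"
proof -
  have bij: "bij_betw (FArr F) (hom A x y) (hom B (FObj F x) (FObj F y))"
    if "x \<in> Obj A" "y \<in> Obj A" for x y
    using assms(1) that by (simp add: fully_faithful_def functorsD[OF F])
  show "f = g" if "f \<in> Arr A" "g \<in> Arr A" "Src A f = Src A g" "Tgt A f = Tgt A g"
      "FArr F f = FArr F g"
    using that bij[of "Src A f" "Tgt A f"] functorsD(3)[OF F]
    by (auto simp: category_rules bij_betw_def inj_on_def hom_def)
  show "\<exists>f \<in> Arr A. Src A f = x \<and> Tgt A f = y \<and> FArr F f = \<beta>"
    if "x \<in> Obj A" "y \<in> Obj A" "\<beta> \<in> Arr B" "Src B \<beta> = FObj F x" "Tgt B \<beta> = FObj F y"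
  proof -
    have "\<beta> \<in> FArr F ` hom A x y"
      using that bij[of x y] by (simp add: bij_betw_def hom_def)
    then show ?thesis by (auto simp: hom_def)
  qed
qed

lemma fully_faithful_lift_iso:
  assumes ff: "fully_faithful F" and F: "F \<in> functors A B"
    and xy: "x \<in> Obj A" "y \<in> Obj A"
    and \<beta>: "iso B \<beta>" "Src B \<beta> = FObj F x" "Tgt B \<beta> = FObj F y"
  obtains f where "iso A f" "Src A f = x" "Tgt A f = y" "FArr F f = \<beta>"
proof -
  note cat = functorsD(3,4)[OF F]
  obtain f where f: "f \<in> Arr A" "Src A f = x" "Tgt A f = y" "FArr F f = \<beta>"
    using fullD[OF ff F xy, of \<beta>] \<beta> inv_arr(1) by metis
  obtain g where g: "g \<in> Arr A" "Src A g = y" "Tgt A g = x" "FArr F g = inv_arr B \<beta>"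
    using fullD[OF ff F xy(2,1), of "inv_arr B \<beta>"] \<beta> by (auto simp: inv_arr)
  note rules = cat xy f g \<beta> inv_arr functorsD[OF F] category_rules
  have "iso A f"
  proof (rule isoI[OF f(1) g(1)])
    show "g \<cdot>\<^bsub>A\<^esub> f = Ide A (Src A f)"
      by (rule faithfulD[OF ff F]) (simp_all add: rules)
    show "f \<cdot>\<^bsub>A\<^esub> g = Ide A (Tgt A f)"
      by (rule faithfulD[OF ff F]) (simp_all add: rules)
  qed (simp_all add: f g)
  with f that show ?thesis by blast
qed

lemma fully_faithful_groupoid:
  assumes ff: "fully_faithful F" and F: "F \<in> functors A B" and B: "groupoid B"
  shows "groupoid A"
  unfolding groupoid_def
proof (intro conjI ballI)
  show A: "category A" using F by (rule functorsD)
  fix f assume f: "f \<in> Arr A"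
  obtain g where g: "iso A g" "Src A g = Src A f" "Tgt A g = Tgt A f" "FArr F g = FArr F f"
    using fully_faithful_lift_iso[OF ff F, of "Src A f" "Tgt A f" "FArr F f"] f A B
    by (auto simp: category_rules functorsD[OF F] groupoid_def)
  then have "g = f" by (intro faithfulD[OF ff F]) (simp_all add: f inv_arr)
  with g show "iso A f" by simp
qed

lemma fully_faithful_cancel_functor:
  assumes ff: "fully_faithful F" and F: "F \<in> functors A B"
    and P: "P \<in> functors C A" and Q: "Q \<in> functors C A"
    and obj: "\<And>x. x \<in> Obj C \<Longrightarrow> FObj P x = FObj Q x" and eq: "F \<circ>\<^sub>F P = F \<circ>\<^sub>F Q"
  shows "P = Q"
proof (rule functor_eqI[OF P Q])
  fix f assume f: "f \<in> Arr C"
  show "FArr P f = FArr Q f"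
    using f obj functorsD(3)[OF P] comp_fun_eqD(2)[OF eq _ _ f]
    by (intro faithfulD[OF ff F]) (simp_all add: functorsD[OF P] functorsD[OF Q] category_rules)
qed

text \<open>
  A factorisation through a fully faithful functor is determined by its object map, which can be
  prescribed freely as long as it lies over the given one. This solves the lifting problems
  against trivial fibrations and produces quasi-inverses and sections.
\<close>

lemma fully_faithful_lift:
  assumes ff: "fully_faithful F" and F: "F \<in> functors A B" and H: "H \<in> functors C B"
    and s: "\<And>x. x \<in> Obj C \<Longrightarrow> s x \<in> Obj A" "\<And>x. x \<in> Obj C \<Longrightarrow> FObj F (s x) = FObj H x"
  obtains L where "L \<in> functors C A" "F \<circ>\<^sub>F L = H" "\<And>x. x \<in> Obj C \<Longrightarrow> FObj L x = s x"
proof -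
  note cat = functorsD(3,4)[OF F] functorsD(3)[OF H]
  have "\<forall>f \<in> Arr C. \<exists>g. g \<in> Arr A \<and> Src A g = s (Src C f) \<and> Tgt A g = s (Tgt C f) \<and>
      FArr F g = FArr H f"
  proof
    fix f assume f: "f \<in> Arr C"
    show "\<exists>g. g \<in> Arr A \<and> Src A g = s (Src C f) \<and> Tgt A g = s (Tgt C f) \<and> FArr F g = FArr H f"
      using fullD[OF ff F, of "s (Src C f)" "s (Tgt C f)" "FArr H f"] f
      by (auto simp: s functorsD[OF H] category_rules)
  qed
  then obtain l where l: "\<And>f. f \<in> Arr C \<Longrightarrow> l f \<in> Arr A \<and> Src A (l f) = s (Src C f) \<and>
      Tgt A (l f) = s (Tgt C f) \<and> FArr F (l f) = FArr H f"
    by metis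
  define L where "L = mk_functor C A s l"
  note rules = cat s l functorsD[OF F] functorsD[OF H] category_rules
  have L: "L \<in> functors C A"
    unfolding L_def
  proof (rule mk_functor)
    show "l (Ide C x) = Ide A (s x)" if "x \<in> Obj C" for x
      using that by (intro faithfulD[OF ff F]) (simp_all add: rules)
    show "l (g \<cdot>\<^bsub>C\<^esub> f) = l g \<cdot>\<^bsub>A\<^esub> l f" if "f \<in> Arr C" "g \<in> Arr C" "Tgt C f = Src C g" for f g
      using that by (intro faithfulD[OF ff F]) (simp_all add: rules)
  qed (simp_all add: cat s l)
  have "F \<circ>\<^sub>F L = H"
    by (rule functor_eqI[OF comp_fun[OF L F] H]) (simp_all add: L_def l)
  moreover have "FObj L x = s x" if "x \<in> Obj C" for x using that by (simp add: L_def)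
  ultimately show ?thesis using L that by blast
qed

lemma fully_faithful_reflects_isomorphic:
  assumes ff: "fully_faithful F" and F: "F \<in> functors A B"
    and P: "P \<in> functors C A" and Q: "Q \<in> functors C A" and iso: "F \<circ>\<^sub>F P \<cong>\<^sub>F F \<circ>\<^sub>F Q"
  shows "P \<cong>\<^sub>F Q"
proof -
  note cat = functorsD(3,4)[OF F] functorsD(3)[OF P]
  obtain \<eta> where "F \<circ>\<^sub>F Q \<in> functors C B" and \<eta>:
    "\<And>x. x \<in> Obj C \<Longrightarrow> iso B (\<eta> x)"
    "\<And>x. x \<in> Obj C \<Longrightarrow> Src B (\<eta> x) = FObj (F \<circ>\<^sub>F P) x"
    "\<And>x. x \<in> Obj C \<Longrightarrow> Tgt B (\<eta> x) = FObj (F \<circ>\<^sub>F Q) x"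
    "\<And>f. f \<in> Arr C \<Longrightarrow>
      FArr (F \<circ>\<^sub>F Q) f \<cdot>\<^bsub>B\<^esub> \<eta> (Src C f) = \<eta> (Tgt C f) \<cdot>\<^bsub>B\<^esub> FArr (F \<circ>\<^sub>F P) f"
    using isomorphic_functorsE[OF iso comp_fun[OF P F]] by blast
  have "\<forall>x \<in> Obj C. \<exists>f. iso A f \<and> Src A f = FObj P x \<and> Tgt A f = FObj Q x \<and> FArr F f = \<eta> x"
  proof
    fix x assume x: "x \<in> Obj C"
    show "\<exists>f. iso A f \<and> Src A f = FObj P x \<and> Tgt A f = FObj Q x \<and> FArr F f = \<eta> x"
      using fully_faithful_lift_iso[OF ff F, of "FObj P x" "FObj Q x" "\<eta> x"] x
      by (auto simp: \<eta>(1-3) functorsD[OF P] functorsD[OF Q])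
  qed
  then obtain \<theta> where \<theta>: "\<And>x. x \<in> Obj C \<Longrightarrow> iso A (\<theta> x) \<and> Src A (\<theta> x) = FObj P x \<and>
      Tgt A (\<theta> x) = FObj Q x \<and> FArr F (\<theta> x) = \<eta> x" by metis
  show ?thesis
  proof (rule isomorphic_functorsI[OF P Q, of \<theta>])
    fix f assume f: "f \<in> Arr C"
    note rules = f cat \<theta> inv_arr functorsD[OF F] functorsD[OF P] functorsD[OF Q] category_rules
    show "FArr Q f \<cdot>\<^bsub>A\<^esub> \<theta> (Src C f) = \<theta> (Tgt C f) \<cdot>\<^bsub>A\<^esub> FArr P f"
      using \<eta>(4)[OF f] by (intro faithfulD[OF ff F]) (simp_all add: rules)
  qed (simp_all add: \<theta>)
qed

text \<open>
  The functor obtained from \<open>G\<close> by moving each value \<open>G x\<close> along an isomorphism \<open>\<theta> x\<close> starting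
  there: an arrow \<open>f : x \<rightarrow> y\<close> goes to \<open>\<theta> y \<cdot> G f \<cdot> (\<theta> x)\<^sup>-\<^sup>1\<close>. Isomorphisms can thus be chosen
  object by object; functoriality and naturality are automatic.
\<close>

definition conj_fun :: "('o, 'a, 'p, 'b) cfunctor \<Rightarrow> ('o \<Rightarrow> 'b) \<Rightarrow> ('o, 'a, 'p, 'b) cfunctor" where
  "conj_fun G \<theta> = (let A = FDom G; B = FCod G in
     mk_functor A B (\<lambda>x. Tgt B (\<theta> x))
       (\<lambda>f. \<theta> (Tgt A f) \<cdot>\<^bsub>B\<^esub> (FArr G f \<cdot>\<^bsub>B\<^esub> inv_arr B (\<theta> (Src A f)))))"

lemma conj_fun:
  assumes G: "G \<in> functors A B"
    and iso: "\<And>x. x \<in> Obj A \<Longrightarrow> iso B (\<theta> x)"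
    and Src: "\<And>x. x \<in> Obj A \<Longrightarrow> Src B (\<theta> x) = FObj G x"
  shows "conj_fun G \<theta> \<in> functors A B"
    and "x \<in> Obj A \<Longrightarrow> FObj (conj_fun G \<theta>) x = Tgt B (\<theta> x)"
    and "f \<in> Arr A \<Longrightarrow> FArr (conj_fun G \<theta>) f =
      \<theta> (Tgt A f) \<cdot>\<^bsub>B\<^esub> (FArr G f \<cdot>\<^bsub>B\<^esub> inv_arr B (\<theta> (Src A f)))"
    and "G \<cong>\<^sub>F conj_fun G \<theta>"
proof -
  note cat = functorsD(3,4)[OF G]
  note rules = cat iso Src inv_arr inv_arr_cancel functorsD[OF G] category_rules
  show conj: "conj_fun G \<theta> \<in> functors A B"
    unfolding conj_fun_def functorsD(1,2)[OF G] Let_def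
    by (rule mk_functor) (simp_all add: rules)
  show obj: "x \<in> Obj A \<Longrightarrow> FObj (conj_fun G \<theta>) x = Tgt B (\<theta> x)" for x
    by (simp add: conj_fun_def functorsD[OF G] Let_def)
  show arr: "f \<in> Arr A \<Longrightarrow> FArr (conj_fun G \<theta>) f =
      \<theta> (Tgt A f) \<cdot>\<^bsub>B\<^esub> (FArr G f \<cdot>\<^bsub>B\<^esub> inv_arr B (\<theta> (Src A f)))" for f
    by (simp add: conj_fun_def functorsD[OF G] Let_def)
  show "G \<cong>\<^sub>F conj_fun G \<theta>"
    by (rule isomorphic_functorsI[OF G conj, of \<theta>]) (simp_all add: obj arr rules)
qed

text \<open>
  An arrow \<open>f\<close> is recovered from \<open>G (F f)\<close> by conjugating with the natural isomorphism.
\<close>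

lemma isomorphic_to_id_faithful:
  assumes F: "F \<in> functors A B" and G: "G \<in> functors B A" and iso: "G \<circ>\<^sub>F F \<cong>\<^sub>F id_fun A"
    and fg: "f \<in> Arr A" "g \<in> Arr A" "Src A f = Src A g" "Tgt A f = Tgt A g" "FArr F f = FArr F g"
  shows "f = g"
proof -
  note cat = functorsD(3,4)[OF F]
  obtain \<eta> where "id_fun A \<in> functors A A" and \<eta>:
    "\<And>x. x \<in> Obj A \<Longrightarrow> iso A (\<eta> x)"
    "\<And>x. x \<in> Obj A \<Longrightarrow> Src A (\<eta> x) = FObj (G \<circ>\<^sub>F F) x"
    "\<And>x. x \<in> Obj A \<Longrightarrow> Tgt A (\<eta> x) = FObj (id_fun A) x"
    "\<And>f. f \<in> Arr A \<Longrightarrow>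
      FArr (id_fun A) f \<cdot>\<^bsub>A\<^esub> \<eta> (Src A f) = \<eta> (Tgt A f) \<cdot>\<^bsub>A\<^esub> FArr (G \<circ>\<^sub>F F) f"
    using isomorphic_functorsE[OF iso comp_fun[OF F G]] by blast
  have "h = \<eta> (Tgt A h) \<cdot>\<^bsub>A\<^esub> (FArr G (FArr F h) \<cdot>\<^bsub>A\<^esub> inv_arr A (\<eta> (Src A h)))" if h: "h \<in> Arr A" for h
  proof -
    have "h = (h \<cdot>\<^bsub>A\<^esub> \<eta> (Src A h)) \<cdot>\<^bsub>A\<^esub> inv_arr A (\<eta> (Src A h))"
      using h by (simp add: cat \<eta>(1-3) category_rules inv_arr functorsD[OF F])
    also have "h \<cdot>\<^bsub>A\<^esub> \<eta> (Src A h) = \<eta> (Tgt A h) \<cdot>\<^bsub>A\<^esub> FArr G (FArr F h)"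
      using \<eta>(4)[OF h] h by (simp add: functorsD[OF F])
    finally show ?thesis
      using h by (simp add: cat \<eta>(1-3) category_rules inv_arr functorsD[OF F] functorsD[OF G])
  qed
  from this[of f] this[of g] fg show ?thesis by simp
qed

text \<open>
  For the quasi-inverse of a fully faithful, essentially surjective \<open>F\<close>, conjugate the identity
  of the codomain into the image of \<open>F\<close> and lift the result through \<open>F\<close>.
\<close>

lemma equivalence_iff_ff_eso:
  assumes F: "F \<in> functors A B"
  shows "equivalence_of_categories F \<longleftrightarrow> fully_faithful F \<and> essentially_surjective F"
proof
  assume "equivalence_of_categories F"
  then obtain G where G: "G \<in> functors B A" and GF: "G \<circ>\<^sub>F F \<cong>\<^sub>F id_fun A" and FG: "F \<circ>\<^sub>F G \<cong>\<^sub>F id_fun B"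
    using equivalenceE[OF _ F] by blast
  note cat = functorsD(3,4)[OF F]
  obtain \<eta> where "id_fun A \<in> functors A A" and \<eta>:
    "\<And>x. x \<in> Obj A \<Longrightarrow> iso A (\<eta> x)"
    "\<And>x. x \<in> Obj A \<Longrightarrow> Src A (\<eta> x) = FObj (G \<circ>\<^sub>F F) x"
    "\<And>x. x \<in> Obj A \<Longrightarrow> Tgt A (\<eta> x) = FObj (id_fun A) x"
    "\<And>f. f \<in> Arr A \<Longrightarrow>
      FArr (id_fun A) f \<cdot>\<^bsub>A\<^esub> \<eta> (Src A f) = \<eta> (Tgt A f) \<cdot>\<^bsub>A\<^esub> FArr (G \<circ>\<^sub>F F) f"
    using isomorphic_functorsE[OF GF comp_fun[OF F G]] by blast
  obtain \<epsilon> where "id_fun B \<in> functors B B" and \<epsilon>: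
    "\<And>x. x \<in> Obj B \<Longrightarrow> iso B (\<epsilon> x)"
    "\<And>x. x \<in> Obj B \<Longrightarrow> Src B (\<epsilon> x) = FObj (F \<circ>\<^sub>F G) x"
    "\<And>x. x \<in> Obj B \<Longrightarrow> Tgt B (\<epsilon> x) = FObj (id_fun B) x"
    "\<And>f. f \<in> Arr B \<Longrightarrow>
      FArr (id_fun B) f \<cdot>\<^bsub>B\<^esub> \<epsilon> (Src B f) = \<epsilon> (Tgt B f) \<cdot>\<^bsub>B\<^esub> FArr (F \<circ>\<^sub>F G) f"
    using isomorphic_functorsE[OF FG comp_fun[OF G F]] by blast
  have "fully_faithful F"
  proof (rule fully_faithfulI[OF F isomorphic_to_id_faithful[OF F G GF]])
    fix x y \<beta> assume xy: "x \<in> Obj A" "y \<in> Obj A"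
      and \<beta>: "\<beta> \<in> Arr B" "Src B \<beta> = FObj F x" "Tgt B \<beta> = FObj F y"
    define f where "f = \<eta> y \<cdot>\<^bsub>A\<^esub> (FArr G \<beta> \<cdot>\<^bsub>A\<^esub> inv_arr A (\<eta> x))"
    note rules = cat xy \<beta> \<eta>(1-3) functorsD[OF F] functorsD[OF G] inv_arr inv_arr_cancel category_rules
    have f: "f \<in> Arr A" "Src A f = x" "Tgt A f = y"
      by (simp_all add: f_def rules)
    have "f \<cdot>\<^bsub>A\<^esub> \<eta> x = \<eta> y \<cdot>\<^bsub>A\<^esub> FArr G \<beta>" by (simp add: f_def rules)
    then have "\<eta> y \<cdot>\<^bsub>A\<^esub> FArr G (FArr F f) = \<eta> y \<cdot>\<^bsub>A\<^esub> FArr G \<beta>"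
      using \<eta>(4)[OF f(1)] f by (simp add: functorsD[OF F])
    then have "inv_arr A (\<eta> y) \<cdot>\<^bsub>A\<^esub> (\<eta> y \<cdot>\<^bsub>A\<^esub> FArr G (FArr F f))
      = inv_arr A (\<eta> y) \<cdot>\<^bsub>A\<^esub> (\<eta> y \<cdot>\<^bsub>A\<^esub> FArr G \<beta>)"
      by simp
    then have "FArr G (FArr F f) = FArr G \<beta>" by (simp add: rules f)
    then have "FArr F f = \<beta>"
      by (intro isomorphic_to_id_faithful[OF G F FG]) (simp_all add: f \<beta> functorsD[OF F])
    with f show "\<exists>f \<in> Arr A. Src A f = x \<and> Tgt A f = y \<and> FArr F f = \<beta>" by blast
  qed
  moreover have "essentially_surjective F"
    unfolding essentially_surjective_def functorsD(1,2)[OF F]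
  proof
    fix b assume b: "b \<in> Obj B"
    then show "\<exists>a \<in> Obj A. \<exists>\<phi>. iso B \<phi> \<and> Src B \<phi> = FObj F a \<and> Tgt B \<phi> = b"
      using \<epsilon>(1-3)[OF b] by (intro bexI[of _ "FObj G b"] exI[of _ "\<epsilon> b"]) (simp_all add: functorsD[OF G])
  qed
  ultimately show "fully_faithful F \<and> essentially_surjective F" ..
next
  assume "fully_faithful F \<and> essentially_surjective F"
  then have ff: "fully_faithful F" and eso: "essentially_surjective F" by auto
  note cat = functorsD(3,4)[OF F]
  obtain s \<phi> where s: "\<And>b. b \<in> Obj B \<Longrightarrow> s b \<in> Obj A"
    and \<phi>: "\<And>b. b \<in> Obj B \<Longrightarrow> iso B (\<phi> b) \<and> Src B (\<phi> b) = FObj F (s b) \<and> Tgt B (\<phi> b) = b"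
    using eso unfolding essentially_surjective_def functorsD(1,2)[OF F] by metis
  define H where "H = conj_fun (id_fun B) (\<lambda>b. inv_arr B (\<phi> b))"
  have "H \<in> functors B B" "id_fun B \<cong>\<^sub>F H"
    and Hobj: "b \<in> Obj B \<Longrightarrow> FObj H b = FObj F (s b)" for b
    unfolding H_def using conj_fun[OF id_fun[OF cat(2)], of "\<lambda>b. inv_arr B (\<phi> b)"] cat(2) \<phi>
    by (simp_all add: iso_inv_arr inv_arr)
  note H = this
  obtain G where G: "G \<in> functors B A" "F \<circ>\<^sub>F G = H"
    using fully_faithful_lift[OF ff F H(1), of s] s Hobj by metis
  show "equivalence_of_categories F"
  proof (rule equivalenceI[OF F G(1)])
    show FG: "F \<circ>\<^sub>F G \<cong>\<^sub>F id_fun B" using H(2) G(2) by (simp add: isomorphic_functors_sym)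
    have "F \<circ>\<^sub>F (G \<circ>\<^sub>F F) \<cong>\<^sub>F F \<circ>\<^sub>F id_fun A"
      using isomorphic_functors_whisker_right[OF FG comp_fun[OF G(1) F] F]
      by (simp add: comp_fun_assoc[OF F G(1) F] comp_id_fun[OF F] id_comp_fun[OF F])
    then show "G \<circ>\<^sub>F F \<cong>\<^sub>F id_fun A"
      by (rule fully_faithful_reflects_isomorphic[OF ff F comp_fun[OF F G(1)] id_fun[OF cat(1)]])
  qed
qed

section \<open>Iso-fibrations\<close>

lemma one_cat_simps [simp]: "Obj one_cat = UNIV" "Arr one_cat = UNIV" "Ide one_cat x = ()"
  by (simp_all add: one_cat_def)

lemma category_one_cat: "category one_cat"
  by unfold_locales (simp_all add: one_cat_def)

lemma interval_simps [simp]: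
  "Obj interval = UNIV" "Arr interval = UNIV" "Src interval f = fst f" "Tgt interval f = snd f"
  "Ide interval x = (x, x)" "g \<cdot>\<^bsub>interval\<^esub> f = (fst f, snd g)"
  by (simp_all add: interval_def)

lemma i0: "i0 \<in> functors one_cat interval"
  by (simp add: functors_def i0_def pick_def category_one_cat category_interval extensional_def PiE_def)

lemma i0_simps [simp]: "FDom i0 = one_cat" "FObj i0 x = E0" "FArr i0 f = (E0, E0)"
  by (simp_all add: i0_def pick_def)

lemma collapse: "collapse \<in> functors interval one_cat"
  by (simp add: functors_def collapse_def category_one_cat category_interval extensional_def PiE_def)

lemma collapse_simps [simp]: "FDom collapse = interval" "FObj collapse e = ()" "FArr collapse f = ()"
  by (simp_all add: collapse_def)

lemma interval_iso: "iso interval f"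
  using groupoid_interval by (cases f) (simp add: groupoid_def)

lemma interval_inv: "inv_arr interval f = (snd f, fst f)"
  by (rule inv_arr_eqI) (simp_all add: category_interval interval_iso)

definition const_fun :: "('o, 'a) cat \<Rightarrow> ('p, 'b) cat \<Rightarrow> 'p \<Rightarrow> ('o, 'a, 'p, 'b) cfunctor" where
  "const_fun A B b = mk_functor A B (\<lambda>_. b) (\<lambda>_. Ide B b)"

lemma const_fun:
  assumes "category A" "category B" "b \<in> Obj B"
  shows "const_fun A B b \<in> functors A B"
  unfolding const_fun_def by (rule mk_functor) (simp_all add: assms category_rules)

lemma const_fun_simps [simp]:
  "FDom (const_fun A B b) = A" "FCod (const_fun A B b) = B"
  "x \<in> Obj A \<Longrightarrow> FObj (const_fun A B b) x = b"
  "f \<in> Arr A \<Longrightarrow> FArr (const_fun A B b) f = Ide B b"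
  by (simp_all add: const_fun_def)

text \<open>
  The functor is the constant one at the source of \<open>\<psi>\<close>, conjugated at \<open>E1\<close> by \<open>\<psi>\<close>; this works in
  any category, whereas \<open>interval_free\<close> concerns groupoids.
\<close>

lemma interval_functor:
  assumes A: "category A" and \<psi>: "iso A \<psi>"
  obtains L where "L \<in> functors interval A" "FArr L (E0, E1) = \<psi>"
proof -
  define x where "x = Src A \<psi>"
  have Src: "Src A \<psi> = x" by (simp add: x_def)
  have x: "x \<in> Obj A" using inv_arr(1)[OF \<psi>] A by (simp add: x_def category_rules)
  define \<theta> where "\<theta> e = (case e of E0 \<Rightarrow> Ide A x | E1 \<Rightarrow> \<psi>)" for e
  have \<theta>: "iso A (\<theta> e)" "Src A (\<theta> e) = FObj (const_fun interval A x) e" for e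
    using \<psi> x A by (auto simp: \<theta>_def iso_Ide category_rules Src split: endpoint.splits)
  note conj = conj_fun[OF const_fun[OF category_interval A x], of \<theta>, OF \<theta>]
  have "FArr (conj_fun (const_fun interval A x) \<theta>) (E0, E1) = \<psi>"
    using inv_arr(1)[OF \<psi>] x A by (simp add: conj(3) \<theta>_def inv_arr_Ide category_rules Src)
  with conj(1) that show ?thesis by blast
qed

lemma interval_functor_Ide:
  assumes L: "L \<in> functors interval A"
  shows "FArr L (e, e) = Ide A (FObj L e)"
  using functorsD(9)[OF L, of e] by simp

lemma interval_functor_eqI:
  assumes L: "L \<in> functors interval A" and M: "M \<in> functors interval A"
    and eq: "FArr L (E0, E1) = FArr M (E0, E1)"
  shows "L = M"
proof (rule functor_eqI[OF L M])
  have obj: "FObj L e = FObj M e" for e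
    using functorsD(7,8)[OF L, of "(E0, E1)"] functorsD(7,8)[OF M, of "(E0, E1)"] eq
    by (cases e) auto
  have "FArr L (inv_arr interval (E0, E1)) = FArr M (inv_arr interval (E0, E1))"
    by (simp only: functor_iso(2)[OF L interval_iso] functor_iso(2)[OF M interval_iso] eq)
  then have inv: "FArr L (E1, E0) = FArr M (E1, E0)" by (simp add: interval_inv)
  show "FArr L f = FArr M f" for f
  proof (cases f)
    case (Pair x y)
    then show ?thesis
      using eq inv by (cases x; cases y) (simp_all add: interval_functor_Ide[OF L] interval_functor_Ide[OF M] obj)
  qed
qed

definition isofibration :: "('o, 'a, 'p, 'b) cfunctor \<Rightarrow> bool" where
  "isofibration F \<longleftrightarrow> (\<forall>x \<in> Obj (FDom F). \<forall>\<phi>. iso (FCod F) \<phi> \<and> Src (FCod F) \<phi> = FObj F x \<longrightarrow>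
     (\<exists>\<psi>. iso (FDom F) \<psi> \<and> Src (FDom F) \<psi> = x \<and> FArr F \<psi> = \<phi>))"

lemma isofibrationI:
  assumes F: "F \<in> functors A B"
    and "\<And>x \<phi>. \<lbrakk>x \<in> Obj A; iso B \<phi>; Src B \<phi> = FObj F x\<rbrakk> \<Longrightarrow>
      \<exists>\<psi>. iso A \<psi> \<and> Src A \<psi> = x \<and> FArr F \<psi> = \<phi>"
  shows "isofibration F"
  using assms by (auto simp: isofibration_def functorsD(1,2)[OF F])

lemma isofibrationE:
  assumes "isofibration F" and F: "F \<in> functors A B"
    and "x \<in> Obj A" "iso B \<phi>" "Src B \<phi> = FObj F x"
  obtains \<psi> where "iso A \<psi>" "Src A \<psi> = x" "FArr F \<psi> = \<phi>"
  using assms by (auto simp: isofibration_def functorsD(1,2)[OF F])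

text \<open>
  By choice, a cleavage is the mere existence of lifts. Normality costs nothing, since for a
  constant path the constant lift can be chosen.
\<close>

lemma normally_cloven_isofibration_iff:
  assumes F: "F \<in> functors A B"
  shows "normally_cloven_isofibration F \<longleftrightarrow> isofibration F"
proof
  note cat = functorsD(3,4)[OF F]
  assume "normally_cloven_isofibration F"
  then obtain l where l: "\<And>a g. \<lbrakk>a \<in> functors one_cat A; g \<in> functors interval B;
      g \<circ>\<^sub>F i0 = F \<circ>\<^sub>F a\<rbrakk> \<Longrightarrow> l a g \<in> functors interval A \<and> l a g \<circ>\<^sub>F i0 = a \<and> F \<circ>\<^sub>F l a g = g"
    unfolding normally_cloven_isofibration_def functorsD(1,2)[OF F] by blast
  show "isofibration F"
  proof (rule isofibrationI[OF F])
    fix x \<phi> assume x: "x \<in> Obj A" and \<phi>: "iso B \<phi>" "Src B \<phi> = FObj F x"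
    define a where "a = const_fun one_cat A x"
    have a: "a \<in> functors one_cat A" using const_fun[OF category_one_cat cat(1) x] by (simp add: a_def)
    obtain g where g: "g \<in> functors interval B" "FArr g (E0, E1) = \<phi>"
      using interval_functor[OF cat(2) \<phi>(1)] .
    have g0: "FObj g E0 = FObj F x" using functorsD(7)[OF g(1), of "(E0, E1)"] g(2) \<phi>(2) by simp
    have "g \<circ>\<^sub>F i0 = F \<circ>\<^sub>F a"
      by (rule functor_eqI[OF comp_fun[OF i0 g(1)] comp_fun[OF a F]])
        (simp add: a_def interval_functor_Ide[OF g(1)] g0 functorsD(9)[OF F x])
    then have L: "l a g \<in> functors interval A" "l a g \<circ>\<^sub>F i0 = a" "F \<circ>\<^sub>F l a g = g"
      using l[OF a g(1)] by auto
    have "FObj (l a g) E0 = x"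
      using arg_cong[OF L(2), of "\<lambda>a. FObj a ()"] by (simp add: a_def)
    moreover have "FArr F (FArr (l a g) (E0, E1)) = \<phi>"
      using arg_cong[OF L(3), of "\<lambda>g. FArr g (E0, E1)"] g(2) by (simp add: functorsD[OF L(1)])
    ultimately show "\<exists>\<psi>. iso A \<psi> \<and> Src A \<psi> = x \<and> FArr F \<psi> = \<phi>"
      using functor_iso(1)[OF L(1) interval_iso] functorsD(7)[OF L(1), of "(E0, E1)"] by auto
  qed
next
  note cat = functorsD(3,4)[OF F]
  assume fib: "isofibration F"
  have ex: "\<exists>L. L \<in> functors interval A \<and> L \<circ>\<^sub>F i0 = a \<and> F \<circ>\<^sub>F L = g \<and>
      (g = F \<circ>\<^sub>F a \<circ>\<^sub>F collapse \<longrightarrow> L = a \<circ>\<^sub>F collapse)"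
    if a: "a \<in> functors one_cat A" and g: "g \<in> functors interval B" and eq: "g \<circ>\<^sub>F i0 = F \<circ>\<^sub>F a" for a g
  proof (cases "g = F \<circ>\<^sub>F a \<circ>\<^sub>F collapse")
    case True
    have ac: "a \<circ>\<^sub>F collapse \<in> functors interval A" by (rule comp_fun[OF collapse a])
    have "(a \<circ>\<^sub>F collapse) \<circ>\<^sub>F i0 = a"
      by (rule functor_eqI[OF comp_fun[OF i0 ac] a]) simp
    with True ac show ?thesis by (intro exI[of _ "a \<circ>\<^sub>F collapse"]) simp
  next
    case False
    have x: "FObj a () \<in> Obj A" by (simp add: functorsD[OF a])
    have "Src B (FArr g (E0, E1)) = FObj F (FObj a ())"
      using comp_fun_eqD(1)[OF eq, of one_cat "()"] by (simp add: functorsD[OF g] functorsD[OF a])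
    then obtain \<psi> where \<psi>: "iso A \<psi>" "Src A \<psi> = FObj a ()" "FArr F \<psi> = FArr g (E0, E1)"
      using isofibrationE[OF fib F x functor_iso(1)[OF g interval_iso]] by metis
    obtain L where L: "L \<in> functors interval A" "FArr L (E0, E1) = \<psi>"
      using interval_functor[OF cat(1) \<psi>(1)] .
    have "FObj L E0 = FObj a ()" using functorsD(7)[OF L(1), of "(E0, E1)"] L(2) \<psi>(2) by simp
    then have "L \<circ>\<^sub>F i0 = a"
      using functorsD(9)[OF a, of "()"]
      by (intro functor_eqI[OF comp_fun[OF i0 L(1)] a]) (simp add: interval_functor_Ide[OF L(1)])
    moreover have "F \<circ>\<^sub>F L = g"
      by (rule interval_functor_eqI[OF comp_fun[OF L(1) F] g]) (simp add: functorsD[OF L(1)] L(2) \<psi>(3))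
    ultimately show ?thesis using L(1) False by blast
  qed
  show "normally_cloven_isofibration F"
    unfolding normally_cloven_isofibration_def functorsD(1,2)[OF F]
  proof (intro conjI F exI ballI impI)
    fix a g assume "a \<in> functors one_cat A" "g \<in> functors interval B" "g \<circ>\<^sub>F i0 = F \<circ>\<^sub>F a"
    from someI_ex[OF ex[OF this]]
    show "(SOME L. L \<in> functors interval A \<and> L \<circ>\<^sub>F i0 = a \<and> F \<circ>\<^sub>F L = g \<and>
      (g = F \<circ>\<^sub>F a \<circ>\<^sub>F collapse \<longrightarrow> L = a \<circ>\<^sub>F collapse)) \<in> functors interval A"
      "(SOME L. L \<in> functors interval A \<and> L \<circ>\<^sub>F i0 = a \<and> F \<circ>\<^sub>F L = g \<and>
      (g = F \<circ>\<^sub>F a \<circ>\<^sub>F collapse \<longrightarrow> L = a \<circ>\<^sub>F collapse)) \<circ>\<^sub>F i0 = a"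
      "F \<circ>\<^sub>F (SOME L. L \<in> functors interval A \<and> L \<circ>\<^sub>F i0 = a \<and> F \<circ>\<^sub>F L = g \<and>
      (g = F \<circ>\<^sub>F a \<circ>\<^sub>F collapse \<longrightarrow> L = a \<circ>\<^sub>F collapse)) = g"
      "g = F \<circ>\<^sub>F a \<circ>\<^sub>F collapse \<Longrightarrow> (SOME L. L \<in> functors interval A \<and> L \<circ>\<^sub>F i0 = a \<and> F \<circ>\<^sub>F L = g \<and>
      (g = F \<circ>\<^sub>F a \<circ>\<^sub>F collapse \<longrightarrow> L = a \<circ>\<^sub>F collapse)) = a \<circ>\<^sub>F collapse"
      by auto
  qed
qed

section \<open>Iso-cofibrations\<close>

lemma prod_cat_simps [simp]:
  "Obj (A \<times>\<^sub>C B) = Obj A \<times> Obj B" "Arr (A \<times>\<^sub>C B) = Arr A \<times> Arr B"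
  "Src (A \<times>\<^sub>C B) (f, g) = (Src A f, Src B g)" "Tgt (A \<times>\<^sub>C B) (f, g) = (Tgt A f, Tgt B g)"
  "Ide (A \<times>\<^sub>C B) (x, y) = (Ide A x, Ide B y)"
  "(f', g') \<cdot>\<^bsub>A \<times>\<^sub>C B\<^esub> (f, g) = (f' \<cdot>\<^bsub>A\<^esub> f, g' \<cdot>\<^bsub>B\<^esub> g)"
  by (simp_all add: prod_cat_def)

lemma category_prod_cat:
  assumes "category A" "category B"
  shows "category (A \<times>\<^sub>C B)"
  using assms by unfold_locales (auto simp: category_rules)

lemma prod_cat_iso:
  assumes "category A" "category B" "iso A f" "iso B g"
  shows "iso (A \<times>\<^sub>C B) (f, g)" "inv_arr (A \<times>\<^sub>C B) (f, g) = (inv_arr A f, inv_arr B g)"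
proof -
  show iso: "iso (A \<times>\<^sub>C B) (f, g)"
    using assms by (intro isoI[of _ _ "(inv_arr A f, inv_arr B g)"]) (simp_all add: inv_arr)
  show "inv_arr (A \<times>\<^sub>C B) (f, g) = (inv_arr A f, inv_arr B g)"
    using assms by (intro inv_arr_eqI iso category_prod_cat) (simp_all add: inv_arr)
qed

lemma incl0:
  assumes "category A"
  shows "incl0 A \<in> functors A (A \<times>\<^sub>C interval)"
proof -
  have "incl0 A = mk_functor A (A \<times>\<^sub>C interval) (\<lambda>x. (x, E0)) (\<lambda>f. (f, (E0, E0)))"
    by (simp add: incl0_def mk_functor_def)
  also have "\<dots> \<in> functors A (A \<times>\<^sub>C interval)"
    using assms by (intro mk_functor category_prod_cat category_interval) auto
  finally show ?thesis .
qed

text \<open>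
  A homotopy out of \<open>g\<close> is a family of isomorphisms starting at the values of \<open>g\<close>. As \<open>j\<close> is
  injective on objects, the isomorphisms prescribed by \<open>h\<close> on its image can be completed by
  identities elsewhere; conjugation of \<open>g\<close> then gives the homotopy, including its naturality.
\<close>

lemma injective_homotopy_extension:
  assumes j: "j \<in> functors A B" and inj: "inj_on (FObj j) (Obj A)"
    and g: "g \<in> functors B Z" and h: "h \<in> functors (A \<times>\<^sub>C interval) Z"
    and eq: "h \<circ>\<^sub>F incl0 A = g \<circ>\<^sub>F j"
  shows "\<exists>k \<in> functors (B \<times>\<^sub>C interval) Z.
    k \<circ>\<^sub>F (j \<times>\<^sub>F id_fun interval) = h \<and> k \<circ>\<^sub>F incl0 B = g"
proof -
  let ?AI = "A \<times>\<^sub>C interval" and ?BI = "B \<times>\<^sub>C interval"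
  note cat = functorsD(3,4)[OF j] functorsD(4)[OF g]
  have catI: "category ?AI" "category ?BI" by (simp_all add: category_prod_cat cat category_interval)
  have h0: "FArr h (f, (E0, E0)) = FArr g (FArr j f)" if "f \<in> Arr A" for f
    using comp_fun_eqD(2)[OF eq, of A f] that by (simp add: incl0_def functorsD(1)[OF j])
  have h0_obj: "FObj h (x, E0) = FObj g (FObj j x)" if "x \<in> Obj A" for x
    using comp_fun_eqD(1)[OF eq, of A x] that by (simp add: incl0_def functorsD(1)[OF j])
  define G where "G = g \<circ>\<^sub>F mk_functor ?BI B fst fst"
  have "mk_functor ?BI B fst fst \<in> functors ?BI B"
    by (rule mk_functor) (auto simp: cat catI)
  then have G: "G \<in> functors ?BI Z" unfolding G_def by (rule comp_fun) (rule g)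
  have Gs: "b \<in> Obj B \<Longrightarrow> FObj G (b, e) = FObj g b" "f \<in> Arr B \<Longrightarrow> FArr G (f, p) = FArr g f" for b e f p
    by (simp_all add: G_def)
  \<comment> \<open>On the image of \<open>j\<close>, the value of \<open>h\<close> on the path from \<open>(x, E0)\<close> to \<open>(x, e)\<close>.\<close>
  define \<theta> where "\<theta> = (\<lambda>(b, e). if b \<in> FObj j ` Obj A
    then FArr h (Ide A (inv_into (Obj A) (FObj j) b), (E0, e)) else Ide Z (FObj g b))"
  have \<theta>j: "\<theta> (FObj j x, e) = FArr h (Ide A x, (E0, e))" if "x \<in> Obj A" for x e
    using that inj by (simp add: \<theta>_def)
  have isoA: "iso ?AI (Ide A x, p)" "inv_arr ?AI (Ide A x, p) = (Ide A x, (snd p, fst p))"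
    if "x \<in> Obj A" for x p
    using that prod_cat_iso[OF cat(1) category_interval iso_Ide[OF cat(1)] interval_iso, of x p]
    by (simp_all add: inv_arr_Ide cat interval_inv)
  have \<theta>: "iso Z (\<theta> q)" "Src Z (\<theta> q) = FObj G q" if q: "q \<in> Obj ?BI" for q
  proof -
    obtain b e where be: "q = (b, e)" "b \<in> Obj B" using q by auto
    have "iso Z (\<theta> (b, e)) \<and> Src Z (\<theta> (b, e)) = FObj g b"
    proof (cases "b \<in> FObj j ` Obj A")
      case True
      then obtain x where x: "x \<in> Obj A" "b = FObj j x" by auto
      then show ?thesis
        using functor_iso(1)[OF h isoA(1)[OF x(1), of "(E0, e)"]]
        by (simp add: \<theta>j functorsD[OF h] cat category_rules h0_obj)
    next
      case False
      then show ?thesis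
        using be by (simp add: \<theta>_def iso_Ide cat functorsD[OF g] category_rules)
    qed
    with be show "iso Z (\<theta> q)" "Src Z (\<theta> q) = FObj G q" by (simp_all add: Gs)
  qed
  have \<theta>0: "\<theta> (b, E0) = Ide Z (FObj g b)" if "b \<in> Obj B" for b
  proof (cases "b \<in> FObj j ` Obj A")
    case True
    then obtain x where x: "x \<in> Obj A" "b = FObj j x" by auto
    then show ?thesis
      by (simp add: \<theta>j h0 cat category_rules functorsD[OF j] functorsD[OF g])
  qed (simp add: \<theta>_def)
  define k where "k = conj_fun G \<theta>"
  note conj = conj_fun[OF G, of \<theta>, OF \<theta>, folded k_def]
  have k: "k \<in> functors ?BI Z" using conj(1) by simp
  have k_arr: "FArr k (f, (e, e')) =
      \<theta> (Tgt B f, e') \<cdot>\<^bsub>Z\<^esub> (FArr g f \<cdot>\<^bsub>Z\<^esub> inv_arr Z (\<theta> (Src B f, e)))"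
    if "f \<in> Arr B" for f e e'
    using that by (subst conj(3)) (simp_all add: Gs)
  have J: "j \<times>\<^sub>F id_fun interval \<in> functors ?AI ?BI"
    and Js: "f \<in> Arr A \<Longrightarrow> FArr (j \<times>\<^sub>F id_fun interval) (f, p) = (FArr j f, p)" for f p
  proof -
    have "j \<times>\<^sub>F id_fun interval
      = mk_functor ?AI ?BI (map_prod (FObj j) (\<lambda>e. e)) (map_prod (FArr j) (\<lambda>p. p))"
      by (simp add: prod_fun_def mk_functor_def functorsD(1,2)[OF j] id_fun_def restrict_UNIV)
    moreover have "mk_functor ?AI ?BI (map_prod (FObj j) (\<lambda>e. e)) (map_prod (FArr j) (\<lambda>p. p))
        \<in> functors ?AI ?BI"
      by (rule mk_functor) (auto simp: catI functorsD[OF j])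
    ultimately show "j \<times>\<^sub>F id_fun interval \<in> functors ?AI ?BI" by simp
    show "f \<in> Arr A \<Longrightarrow> FArr (j \<times>\<^sub>F id_fun interval) (f, p) = (FArr j f, p)"
      by (simp add: prod_fun_def functorsD(1,2)[OF j])
  qed
  have "k \<circ>\<^sub>F (j \<times>\<^sub>F id_fun interval) = h"
  proof (rule functor_eqI[OF comp_fun[OF J k] h])
    fix r assume "r \<in> Arr ?AI"
    then obtain f e e' where f: "r = (f, (e, e'))" "f \<in> Arr A" by auto
    have st: "Src A f \<in> Obj A" "Tgt A f \<in> Obj A" using f cat by (simp_all add: category_rules)
    have inv: "inv_arr Z (\<theta> (FObj j (Src A f), e)) = FArr h (Ide A (Src A f), (e, E0))"
      using functor_iso(2)[OF h isoA(1)[OF st(1)], of "(E0, e)"] st by (simp add: \<theta>j isoA(2))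
    have "FArr (k \<circ>\<^sub>F (j \<times>\<^sub>F id_fun interval)) r = FArr k (FArr j f, (e, e'))"
      using f by (simp add: functorsD(1)[OF J] Js)
    also have "\<dots> = \<theta> (FObj j (Tgt A f), e') \<cdot>\<^bsub>Z\<^esub>
        (FArr g (FArr j f) \<cdot>\<^bsub>Z\<^esub> inv_arr Z (\<theta> (FObj j (Src A f), e)))"
      using f by (simp add: k_arr functorsD[OF j])
    also have "\<dots> = FArr h (Ide A (Tgt A f), (E0, e')) \<cdot>\<^bsub>Z\<^esub>
        (FArr h (f, (E0, E0)) \<cdot>\<^bsub>Z\<^esub> FArr h (Ide A (Src A f), (e, E0)))"
      by (simp only: inv h0[OF f(2)] \<theta>j[OF st(2)])
    also have "\<dots> = FArr h (f, (e, e'))"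
      using f st cat by (simp add: functorsD(10)[OF h, symmetric] category_rules)
    finally show "FArr (k \<circ>\<^sub>F (j \<times>\<^sub>F id_fun interval)) r = FArr h r" using f by simp
  qed
  moreover have "k \<circ>\<^sub>F incl0 B = g"
  proof (rule functor_eqI[OF comp_fun[OF incl0[OF cat(2)] k] g])
    fix f assume f: "f \<in> Arr B"
    have st: "Src B f \<in> Obj B" "Tgt B f \<in> Obj B" using f cat by (simp_all add: category_rules)
    have "FArr (k \<circ>\<^sub>F incl0 B) f = FArr k (f, (E0, E0))"
      using f by (simp add: incl0_def comp_fun_def)
    also have "\<dots> = FArr g f"
      using f st cat by (simp add: k_arr \<theta>0 inv_arr_Ide functorsD[OF g] category_rules)
    finally show "FArr (k \<circ>\<^sub>F incl0 B) f = FArr g f" .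
  qed
  ultimately show ?thesis using k by blast
qed

text \<open>
  Functors into such a category are arbitrary functions on objects, so they detect whether a
  functor identifies two objects.
\<close>

definition chaotic :: "('o, 'a) cat \<Rightarrow> bool" where
  "chaotic C \<longleftrightarrow> (\<forall>x \<in> Obj C. \<forall>y \<in> Obj C. \<exists>!f. f \<in> hom C x y)"

lemma chaotic_functor:
  assumes "category A" "category C" "chaotic C" and s: "\<And>x. x \<in> Obj A \<Longrightarrow> s x \<in> Obj C"
  obtains L where "L \<in> functors A C" "\<And>x. x \<in> Obj A \<Longrightarrow> FObj L x = s x"
proof -
  have ex: "\<exists>!f. f \<in> hom C x y" if "x \<in> Obj C" "y \<in> Obj C" for x y
    using assms(3) that by (simp add: chaotic_def)
  have eq: "f = g" if "f \<in> Arr C" "g \<in> Arr C" "Src C f = Src C g" "Tgt C f = Tgt C g" for f g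
    using ex[of "Src C f" "Tgt C f"] that assms(2) by (auto simp: hom_def category_rules)
  define l where "l f = (THE g. g \<in> hom C (s (Src A f)) (s (Tgt A f)))" for f
  have l: "l f \<in> Arr C" "Src C (l f) = s (Src A f)" "Tgt C (l f) = s (Tgt A f)" if "f \<in> Arr A" for f
    using theI'[OF ex[of "s (Src A f)" "s (Tgt A f)"]] that assms(1) s
    by (auto simp: l_def hom_def category_rules)
  have "mk_functor A C s l \<in> functors A C"
  proof (rule mk_functor)
    show "l (Ide A x) = Ide C (s x)" if "x \<in> Obj A" for x
      using that assms s by (intro eq) (simp_all add: l category_rules)
    show "l (g \<cdot>\<^bsub>A\<^esub> f) = l g \<cdot>\<^bsub>C\<^esub> l f" if "f \<in> Arr A" "g \<in> Arr A" "Tgt A f = Src A g" for f g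
      using that assms s by (intro eq) (simp_all add: l category_rules)
  qed (simp_all add: assms l)
  with that[of "mk_functor A C s l"] show ?thesis by simp
qed

lemma chaotic_functor_eqI:
  assumes "chaotic C" and P: "P \<in> functors A C" and Q: "Q \<in> functors A C"
    and obj: "\<And>x. x \<in> Obj A \<Longrightarrow> FObj P x = FObj Q x"
  shows "P = Q"
proof (rule functor_eqI[OF P Q])
  fix f assume f: "f \<in> Arr A"
  have st: "Src A f \<in> Obj A" "Tgt A f \<in> Obj A" using f functorsD(3)[OF P] by (simp_all add: category_rules)
  have "\<exists>!g. g \<in> hom C (FObj P (Src A f)) (FObj P (Tgt A f))"
    using assms(1) st by (simp add: chaotic_def functorsD[OF P])
  moreover have "FArr P f \<in> hom C (FObj P (Src A f)) (FObj P (Tgt A f))"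
    using f by (simp add: hom_def functorsD[OF P])
  moreover have "FArr Q f \<in> hom C (FObj P (Src A f)) (FObj P (Tgt A f))"
    using f st by (simp add: hom_def functorsD[OF Q] obj)
  ultimately show "FArr P f = FArr Q f" by blast
qed

text \<open>
  If \<open>j\<close> identified \<open>a \<noteq> a'\<close>, the homotopy that starts constantly at \<open>z0\<close> and moves only
  \<open>a\<close> to \<open>z1\<close> could not be extended along \<open>j\<close>.
\<close>

lemma injective_if_homotopy_extension:
  assumes j: "j \<in> functors A B" and Z: "category Z" "chaotic Z" "z0 \<in> Obj Z" "z1 \<in> Obj Z" "z0 \<noteq> z1"
    and ext: "\<And>g h. \<lbrakk>g \<in> functors B Z; h \<in> functors (A \<times>\<^sub>C interval) Z;
      h \<circ>\<^sub>F incl0 A = g \<circ>\<^sub>F j\<rbrakk> \<Longrightarrow>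
      \<exists>k \<in> functors (B \<times>\<^sub>C interval) Z. k \<circ>\<^sub>F (j \<times>\<^sub>F id_fun interval) = h"
  shows "inj_on (FObj j) (Obj A)"
proof (rule inj_onI, rule ccontr)
  fix a a' assume a: "a \<in> Obj A" "a' \<in> Obj A" "FObj j a = FObj j a'" "a \<noteq> a'"
  let ?AI = "A \<times>\<^sub>C interval"
  note cat = functorsD(3,4)[OF j]
  have catI: "category ?AI" by (simp add: category_prod_cat cat category_interval)
  obtain h where h: "h \<in> functors ?AI Z"
    "\<And>q. q \<in> Obj ?AI \<Longrightarrow> FObj h q = (if q = (a, E1) then z1 else z0)"
    using chaotic_functor[OF catI Z(1,2), of "\<lambda>q. if q = (a, E1) then z1 else z0"] Z(3,4)
    by (metis (no_types, lifting))
  define g where "g = const_fun B Z z0"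
  have g: "g \<in> functors B Z" using const_fun[OF cat(2) Z(1,3)] by (simp add: g_def)
  have "h \<circ>\<^sub>F incl0 A = g \<circ>\<^sub>F j"
    by (rule chaotic_functor_eqI[OF Z(2) comp_fun[OF incl0[OF cat(1)] h(1)] comp_fun[OF j g]])
      (simp add: incl0_def functorsD[OF j] h(2) g_def)
  then obtain k where k: "k \<circ>\<^sub>F (j \<times>\<^sub>F id_fun interval) = h"
    using ext[OF g h(1)] by blast
  have "FObj k (FObj j x, E1) = FObj h (x, E1)" if "x \<in> Obj A" for x
    using arg_cong[OF k, of "\<lambda>h. FObj h (x, E1)"] that
    by (simp add: prod_fun_def functorsD(1,2)[OF j])
  from this[OF a(1)] this[OF a(2)] show False using a Z(5) by (simp add: h(2))
qed

section \<open>Lifting\<close>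

definition surjective_on_objects :: "('o, 'a, 'p, 'b) cfunctor \<Rightarrow> bool" where
  "surjective_on_objects F \<longleftrightarrow> FObj F ` Obj (FDom F) = Obj (FCod F)"

definition injective_on_objects :: "('o, 'a, 'p, 'b) cfunctor \<Rightarrow> bool" where
  "injective_on_objects F \<longleftrightarrow> inj_on (FObj F) (Obj (FDom F))"

lemma surjective_on_objectsE:
  assumes "surjective_on_objects F" and F: "F \<in> functors A B" and "b \<in> Obj B"
  obtains a where "a \<in> Obj A" "FObj F a = b"
  using assms unfolding surjective_on_objects_def functorsD(1,2)[OF F] by (metis imageE)

lemma trivial_fibration_iff:
  assumes F: "F \<in> functors A B"
  shows "isofibration F \<and> equivalence_of_categories F \<longleftrightarrow>
    fully_faithful F \<and> surjective_on_objects F"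
proof
  note cat = functorsD(3,4)[OF F]
  assume "isofibration F \<and> equivalence_of_categories F"
  then have fib: "isofibration F" and ff: "fully_faithful F" and eso: "essentially_surjective F"
    using equivalence_iff_ff_eso[OF F] by auto
  have "\<exists>a \<in> Obj A. FObj F a = b" if b: "b \<in> Obj B" for b
  proof -
    obtain a \<phi> where a: "a \<in> Obj A" and \<phi>: "iso B \<phi>" "Src B \<phi> = FObj F a" "Tgt B \<phi> = b"
      using eso b unfolding essentially_surjective_def functorsD(1,2)[OF F] by blast
    obtain \<psi> where "iso A \<psi>" "Src A \<psi> = a" "FArr F \<psi> = \<phi>"
      using isofibrationE[OF fib F a \<phi>(1,2)] .
    with \<phi>(3) show ?thesis
      using functorsD(8)[OF F inv_arr(1)] cat by (intro bexI[of _ "Tgt A \<psi>"]) (auto simp: category_rules inv_arr)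
  qed
  then have "surjective_on_objects F"
    by (auto simp: surjective_on_objects_def functorsD[OF F])
  with ff show "fully_faithful F \<and> surjective_on_objects F" ..
next
  note cat = functorsD(3,4)[OF F]
  assume "fully_faithful F \<and> surjective_on_objects F"
  then have ff: "fully_faithful F" and surj: "\<And>b. b \<in> Obj B \<Longrightarrow> \<exists>a \<in> Obj A. FObj F a = b"
    using surjective_on_objectsE[OF _ F] by metis+
  have "essentially_surjective F"
    unfolding essentially_surjective_def functorsD(1,2)[OF F]
  proof
    fix b assume b: "b \<in> Obj B"
    obtain a where "a \<in> Obj A" "FObj F a = b" using surj[OF b] by blast
    with b show "\<exists>a \<in> Obj A. \<exists>\<phi>. iso B \<phi> \<and> Src B \<phi> = FObj F a \<and> Tgt B \<phi> = b"
      using cat by (intro bexI[of _ a] exI[of _ "Ide B b"]) (simp_all add: iso_Ide category_rules)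
  qed
  moreover have "isofibration F"
  proof (rule isofibrationI[OF F])
    fix x \<phi> assume x: "x \<in> Obj A" and \<phi>: "iso B \<phi>" "Src B \<phi> = FObj F x"
    have "Tgt B \<phi> \<in> Obj B" using \<phi> cat by (simp add: inv_arr category_rules)
    then obtain y where y: "y \<in> Obj A" "FObj F y = Tgt B \<phi>" using surj by blast
    show "\<exists>\<psi>. iso A \<psi> \<and> Src A \<psi> = x \<and> FArr F \<psi> = \<phi>"
      using fully_faithful_lift_iso[OF ff F x y(1) \<phi> y(2)[symmetric]] by metis
  qed
  ultimately show "isofibration F \<and> equivalence_of_categories F"
    using ff equivalence_iff_ff_eso[OF F] by blast
qed

text \<open>
  The object map of the diagonal is \<open>u\<close> on the image of \<open>j\<close> and an arbitrary choice over \<open>v\<close>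
  elsewhere; full faithfulness of \<open>p\<close> does the rest.
\<close>

lemma lift_cofibration_trivial_fibration:
  assumes j: "j \<in> functors A B" and inj: "injective_on_objects j"
    and p: "p \<in> functors X Y" and ff: "fully_faithful p" and surj: "surjective_on_objects p"
    and u: "u \<in> functors A X" and v: "v \<in> functors B Y" and square: "p \<circ>\<^sub>F u = v \<circ>\<^sub>F j"
  shows "\<exists>d \<in> functors B X. d \<circ>\<^sub>F j = u \<and> p \<circ>\<^sub>F d = v"
proof -
  have square_obj: "FObj p (FObj u a) = FObj v (FObj j a)" if "a \<in> Obj A" for a
    using comp_fun_eqD(1)[OF square, of A] that by (simp add: functorsD(1)[OF u] functorsD(1)[OF j])
  have "\<forall>b \<in> Obj B. \<exists>x. x \<in> Obj X \<and> FObj p x = FObj v b \<and> (\<forall>a \<in> Obj A. b = FObj j a \<longrightarrow> x = FObj u a)"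
  proof
    fix b assume b: "b \<in> Obj B"
    show "\<exists>x. x \<in> Obj X \<and> FObj p x = FObj v b \<and> (\<forall>a \<in> Obj A. b = FObj j a \<longrightarrow> x = FObj u a)"
    proof (cases "b \<in> FObj j ` Obj A")
      case True
      then obtain a where a: "a \<in> Obj A" "b = FObj j a" by auto
      then have "\<forall>a' \<in> Obj A. b = FObj j a' \<longrightarrow> a' = a"
        using inj by (auto simp: injective_on_objects_def functorsD(1)[OF j] inj_on_def)
      then show ?thesis
        using a square_obj by (intro exI[of _ "FObj u a"]) (auto simp: functorsD(5)[OF u])
    next
      case False
      have "FObj v b \<in> FObj p ` Obj X"
        using b surj by (simp add: surjective_on_objects_def functorsD(1,2)[OF p] functorsD(5)[OF v])
      with False show ?thesis by auto
    qed
  qed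
  then obtain s where s: "\<And>b. b \<in> Obj B \<Longrightarrow> s b \<in> Obj X" "\<And>b. b \<in> Obj B \<Longrightarrow> FObj p (s b) = FObj v b"
    and sj: "\<And>a. a \<in> Obj A \<Longrightarrow> s (FObj j a) = FObj u a"
    using functorsD(5)[OF j] by metis
  obtain d where d: "d \<in> functors B X" "p \<circ>\<^sub>F d = v" "\<And>b. b \<in> Obj B \<Longrightarrow> FObj d b = s b"
    using fully_faithful_lift[OF ff p v s] by blast
  have "d \<circ>\<^sub>F j = u"
  proof (rule fully_faithful_cancel_functor[OF ff p comp_fun[OF j d(1)] u])
    show "p \<circ>\<^sub>F d \<circ>\<^sub>F j = p \<circ>\<^sub>F u"
      by (simp add: square d(2) comp_fun_assoc[OF j d(1) p, symmetric])
  qed (simp add: functorsD[OF j] d(3) sj)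
  with d show ?thesis by blast
qed

text \<open>
  Choosing the essential preimage of \<open>j a\<close> to be \<open>a\<close> itself, with the identity as comparison,
  makes the quasi-inverse a strict retraction and the comparison \<open>j r \<cong> 1\<close> trivial on the image
  of \<open>j\<close>.
\<close>

lemma strong_deformation_retract:
  assumes j: "j \<in> functors A B" and inj: "injective_on_objects j"
    and eq: "equivalence_of_categories j"
  obtains r \<theta> where "r \<in> functors B A" "r \<circ>\<^sub>F j = id_fun A"
    "\<And>b. b \<in> Obj B \<Longrightarrow> iso B (\<theta> b)"
    "\<And>b. b \<in> Obj B \<Longrightarrow> Src B (\<theta> b) = FObj j (FObj r b)"
    "\<And>b. b \<in> Obj B \<Longrightarrow> Tgt B (\<theta> b) = b"
    "\<And>f. f \<in> Arr B \<Longrightarrow> f \<cdot>\<^bsub>B\<^esub> \<theta> (Src B f) = \<theta> (Tgt B f) \<cdot>\<^bsub>B\<^esub> FArr j (FArr r f)"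
    "\<And>a. a \<in> Obj A \<Longrightarrow> \<theta> (FObj j a) = Ide B (FObj j a)"
proof -
  note cat = functorsD(3,4)[OF j]
  have ff: "fully_faithful j" and eso: "essentially_surjective j"
    using eq equivalence_iff_ff_eso[OF j] by auto
  let ?good = "\<lambda>b a \<phi>. a \<in> Obj A \<and> iso B \<phi> \<and> Src B \<phi> = FObj j a \<and> Tgt B \<phi> = b \<and>
      (\<forall>a' \<in> Obj A. b = FObj j a' \<longrightarrow> a = a' \<and> \<phi> = Ide B b)"
  have "\<forall>b \<in> Obj B. \<exists>a \<phi>. ?good b a \<phi>"
  proof
    fix b assume b: "b \<in> Obj B"
    show "\<exists>a \<phi>. ?good b a \<phi>"
    proof (cases "b \<in> FObj j ` Obj A")
      case True
      then obtain a where a: "a \<in> Obj A" "b = FObj j a" by auto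
      then have "\<forall>a' \<in> Obj A. b = FObj j a' \<longrightarrow> a = a'"
        using inj by (auto simp: injective_on_objects_def functorsD(1)[OF j] inj_on_def)
      then show ?thesis
        using a b cat by (intro exI[of _ a] exI[of _ "Ide B b"]) (simp add: iso_Ide category_rules)
    next
      case False
      with b eso show ?thesis
        unfolding essentially_surjective_def functorsD(1,2)[OF j] by blast
    qed
  qed
  then obtain s where "\<forall>b \<in> Obj B. \<exists>\<phi>. ?good b (s b) \<phi>"
    using bchoice[of "Obj B" "\<lambda>b a. \<exists>\<phi>. ?good b a \<phi>"] by blast
  then obtain \<theta> where "\<forall>b \<in> Obj B. ?good b (s b) (\<theta> b)"
    using bchoice[of "Obj B" "\<lambda>b \<phi>. ?good b (s b) \<phi>"] by blast
  then have s: "\<And>b. b \<in> Obj B \<Longrightarrow> s b \<in> Obj A"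
    and \<theta>: "\<And>b. b \<in> Obj B \<Longrightarrow> iso B (\<theta> b)" "\<And>b. b \<in> Obj B \<Longrightarrow> Src B (\<theta> b) = FObj j (s b)"
      "\<And>b. b \<in> Obj B \<Longrightarrow> Tgt B (\<theta> b) = b"
    and sj: "\<And>b a. \<lbrakk>b \<in> Obj B; a \<in> Obj A; b = FObj j a\<rbrakk> \<Longrightarrow> s b = a \<and> \<theta> b = Ide B b"
    by blast+
  define \<theta>' where "\<theta>' b = inv_arr B (\<theta> b)" for b
  have \<theta>': "iso B (\<theta>' b)" "Src B (\<theta>' b) = FObj (id_fun B) b" if "b \<in> Obj B" for b
    using that cat by (simp_all add: \<theta>'_def \<theta> iso_inv_arr inv_arr)
  define H where "H = conj_fun (id_fun B) \<theta>'"
  note conj = conj_fun[OF id_fun[OF cat(2)], of \<theta>', OF \<theta>', folded H_def]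
  have H: "H \<in> functors B B" using conj(1) by simp
  have H_obj: "FObj j (s b) = FObj H b" if "b \<in> Obj B" for b
    using that by (subst conj(2)) (simp_all add: \<theta>'_def \<theta> inv_arr)
  have H_arr: "FArr H f = inv_arr B (\<theta> (Tgt B f)) \<cdot>\<^bsub>B\<^esub> (f \<cdot>\<^bsub>B\<^esub> \<theta> (Src B f))" if "f \<in> Arr B" for f
    using that cat by (subst conj(3)) (simp_all add: \<theta>'_def \<theta> inv_arr_inv_arr category_rules)
  obtain r where r: "r \<in> functors B A" "j \<circ>\<^sub>F r = H" and r_obj: "\<And>b. b \<in> Obj B \<Longrightarrow> FObj r b = s b"
    using fully_faithful_lift[OF ff j H s H_obj] by blast
  have jr: "FArr j (FArr r f) = FArr H f" if "f \<in> Arr B" for f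
    using arg_cong[OF r(2), of "\<lambda>F. FArr F f"] that by (simp add: functorsD[OF r(1)])
  have nat: "f \<cdot>\<^bsub>B\<^esub> \<theta> (Src B f) = \<theta> (Tgt B f) \<cdot>\<^bsub>B\<^esub> FArr j (FArr r f)" if "f \<in> Arr B" for f
    using that cat by (simp add: jr H_arr inv_arr_cancel inv_arr \<theta> category_rules)
  have \<theta>j: "\<theta> (FObj j a) = Ide B (FObj j a)" if "a \<in> Obj A" for a
    using sj[of "FObj j a" a] that by (simp add: functorsD[OF j])
  have "r \<circ>\<^sub>F j = id_fun A"
  proof (rule functor_eqI[OF comp_fun[OF j r(1)] id_fun[OF cat(1)]])
    fix f assume f: "f \<in> Arr A"
    have st: "Src A f \<in> Obj A" "Tgt A f \<in> Obj A" using f cat by (simp_all add: category_rules)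
    have rj: "FObj r (FObj j a) = a" if "a \<in> Obj A" for a
      using sj[of "FObj j a" a] that by (simp add: r_obj functorsD[OF j])
    have "FArr j (FArr r (FArr j f)) = FArr j f"
      using f st cat by (simp add: jr H_arr functorsD[OF j] \<theta>j inv_arr_Ide category_rules)
    then have "FArr r (FArr j f) = f"
      using f st by (intro faithfulD[OF ff j]) (simp_all add: functorsD[OF j] functorsD[OF r(1)] rj)
    then show "FArr (r \<circ>\<^sub>F j) f = FArr (id_fun A) f" using f by (simp add: functorsD[OF j])
  qed
  from that[OF r(1) this \<theta>(1) _ \<theta>(3) nat \<theta>j] show ?thesis by (simp add: \<theta>(2) r_obj)
qed

text \<open>
  With \<open>\<theta> : j r \<cong> 1\<close> a strong deformation retraction, \<open>u r\<close> is a lift of \<open>v j r\<close>, and \<open>v \<theta>\<close>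
  leads from there to \<open>v\<close>. Lifting the isomorphisms \<open>v (\<theta> b)\<close> along \<open>p\<close> and conjugating \<open>u r\<close> by
  the lifts gives a lift of \<open>v\<close>; identities are lifted to identities over the image of \<open>j\<close>, so
  the upper triangle commutes strictly.
\<close>

lemma lift_trivial_cofibration_fibration:
  assumes j: "j \<in> functors A B" and inj: "injective_on_objects j"
    and eq: "equivalence_of_categories j"
    and p: "p \<in> functors X Y" and fib: "isofibration p"
    and u: "u \<in> functors A X" and v: "v \<in> functors B Y" and square: "p \<circ>\<^sub>F u = v \<circ>\<^sub>F j"
  shows "\<exists>d \<in> functors B X. d \<circ>\<^sub>F j = u \<and> p \<circ>\<^sub>F d = v"
proof -
  note cat = functorsD(3,4)[OF j] functorsD(3,4)[OF p]
  have square_obj: "FObj p (FObj u a) = FObj v (FObj j a)" if "a \<in> Obj A" for a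
    using comp_fun_eqD(1)[OF square, of A] that by (simp add: functorsD(1)[OF u] functorsD(1)[OF j])
  have square_arr: "FArr p (FArr u f) = FArr v (FArr j f)" if "f \<in> Arr A" for f
    using comp_fun_eqD(2)[OF square, of A] that by (simp add: functorsD(1)[OF u] functorsD(1)[OF j])
  obtain r \<theta> where r: "r \<in> functors B A" "r \<circ>\<^sub>F j = id_fun A"
    and \<theta>: "\<And>b. b \<in> Obj B \<Longrightarrow> iso B (\<theta> b)"
      "\<And>b. b \<in> Obj B \<Longrightarrow> Src B (\<theta> b) = FObj j (FObj r b)"
      "\<And>b. b \<in> Obj B \<Longrightarrow> Tgt B (\<theta> b) = b"
    and nat: "\<And>f. f \<in> Arr B \<Longrightarrow> f \<cdot>\<^bsub>B\<^esub> \<theta> (Src B f) = \<theta> (Tgt B f) \<cdot>\<^bsub>B\<^esub> FArr j (FArr r f)"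
    and \<theta>j: "\<And>a. a \<in> Obj A \<Longrightarrow> \<theta> (FObj j a) = Ide B (FObj j a)"
    using strong_deformation_retract[OF j inj eq] by blast
  have rj: "FObj r (FObj j a) = a" if "a \<in> Obj A" for a
    using arg_cong[OF r(2), of "\<lambda>F. FObj F a"] that by (simp add: functorsD(1)[OF j])
  have rj_arr: "FArr r (FArr j f) = f" if "f \<in> Arr A" for f
    using arg_cong[OF r(2), of "\<lambda>F. FArr F f"] that by (simp add: functorsD(1)[OF j])
  define G where "G = u \<circ>\<^sub>F r"
  have G: "G \<in> functors B X" using comp_fun[OF r(1) u] by (simp add: G_def)
  have G_simps: "b \<in> Obj B \<Longrightarrow> FObj G b = FObj u (FObj r b)"
    "f \<in> Arr B \<Longrightarrow> FArr G f = FArr u (FArr r f)" for b f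
    by (simp_all add: G_def functorsD(1)[OF r(1)])
  have "\<forall>b \<in> Obj B. \<exists>\<psi>. iso X \<psi> \<and> Src X \<psi> = FObj G b \<and> FArr p \<psi> = FArr v (\<theta> b) \<and>
      (\<forall>a \<in> Obj A. b = FObj j a \<longrightarrow> \<psi> = Ide X (FObj u a))"
  proof
    fix b assume b: "b \<in> Obj B"
    show "\<exists>\<psi>. iso X \<psi> \<and> Src X \<psi> = FObj G b \<and> FArr p \<psi> = FArr v (\<theta> b) \<and>
      (\<forall>a \<in> Obj A. b = FObj j a \<longrightarrow> \<psi> = Ide X (FObj u a))"
    proof (cases "b \<in> FObj j ` Obj A")
      case True
      then obtain a where a: "a \<in> Obj A" "b = FObj j a" by auto
      have "\<forall>a' \<in> Obj A. b = FObj j a' \<longrightarrow> a' = a" using a rj by metis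
      moreover have "FArr p (Ide X (FObj u a)) = FArr v (\<theta> b)"
        using a b by (simp add: \<theta>j functorsD(5,9)[OF u] functorsD(9)[OF p] functorsD(9)[OF v] square_obj)
      ultimately show ?thesis
        using a b cat by (intro exI[of _ "Ide X (FObj u a)"])
          (auto simp: iso_Ide category_rules functorsD(5)[OF u] G_simps rj)
    next
      case False
      have "FObj G b \<in> Obj X" using b by (simp add: functorsD(5)[OF G])
      moreover have "iso Y (FArr v (\<theta> b))" using functor_iso(1)[OF v] \<theta>(1)[OF b] by blast
      moreover have "Src Y (FArr v (\<theta> b)) = FObj p (FObj G b)"
        using b by (simp add: inv_arr \<theta> functorsD[OF v] functorsD(5)[OF r(1)] G_simps square_obj)
      ultimately show ?thesis
        using isofibrationE[OF fib p] False by (metis imageI)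
    qed
  qed
  then obtain \<psi> where \<psi>: "\<And>b. b \<in> Obj B \<Longrightarrow> iso X (\<psi> b)" "\<And>b. b \<in> Obj B \<Longrightarrow> Src X (\<psi> b) = FObj G b"
    and p\<psi>: "\<And>b. b \<in> Obj B \<Longrightarrow> FArr p (\<psi> b) = FArr v (\<theta> b)"
    and \<psi>j: "\<And>a. a \<in> Obj A \<Longrightarrow> \<psi> (FObj j a) = Ide X (FObj u a)"
    using functorsD(5)[OF j] by metis
  define d where "d = conj_fun G \<psi>"
  note conj = conj_fun[OF G, of \<psi>, OF \<psi>, folded d_def]
  have d: "d \<in> functors B X" using conj(1) by simp
  have d_arr: "FArr d f = \<psi> (Tgt B f) \<cdot>\<^bsub>X\<^esub> (FArr u (FArr r f) \<cdot>\<^bsub>X\<^esub> inv_arr X (\<psi> (Src B f)))"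
    if "f \<in> Arr B" for f
    using that by (subst conj(3)) (simp_all add: G_simps)
  have "d \<circ>\<^sub>F j = u"
  proof (rule functor_eqI[OF comp_fun[OF j d] u])
    fix f assume f: "f \<in> Arr A"
    have st: "Src A f \<in> Obj A" "Tgt A f \<in> Obj A" using f cat by (simp_all add: category_rules)
    show "FArr (d \<circ>\<^sub>F j) f = FArr u f"
      using f st cat by (simp add: functorsD[OF j] d_arr \<psi>j rj_arr inv_arr_Ide functorsD[OF u] category_rules)
  qed
  moreover have "p \<circ>\<^sub>F d = v"
  proof (rule functor_eqI[OF comp_fun[OF d p] v])
    fix f assume f: "f \<in> Arr B"
    have st: "Src B f \<in> Obj B" "Tgt B f \<in> Obj B" using f cat by (simp_all add: category_rules)
    note rules = f st cat inv_arr \<theta> \<psi> category_rules functorsD[OF r(1)] functorsD[OF j]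
    have inv: "FArr p (inv_arr X (\<psi> (Src B f))) = FArr v (inv_arr B (\<theta> (Src B f)))"
      using st by (simp add: functor_iso(2)[OF p] functor_iso(2)[OF v] \<psi> \<theta> p\<psi>)
    have "FArr (p \<circ>\<^sub>F d) f = FArr p (FArr d f)" using f by (simp add: functorsD(1)[OF d])
    also have "\<dots> = FArr p (\<psi> (Tgt B f)) \<cdot>\<^bsub>Y\<^esub>
        (FArr p (FArr u (FArr r f)) \<cdot>\<^bsub>Y\<^esub> FArr p (inv_arr X (\<psi> (Src B f))))"
      by (simp add: d_arr rules functorsD[OF p] functorsD[OF u] G_simps)
    also have "\<dots> = FArr v (\<theta> (Tgt B f)) \<cdot>\<^bsub>Y\<^esub>
        (FArr v (FArr j (FArr r f)) \<cdot>\<^bsub>Y\<^esub> FArr v (inv_arr B (\<theta> (Src B f))))"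
      using f st by (simp add: p\<psi> inv square_arr functorsD(6)[OF r(1)])
    also have "\<dots> = FArr v ((\<theta> (Tgt B f) \<cdot>\<^bsub>B\<^esub> FArr j (FArr r f)) \<cdot>\<^bsub>B\<^esub> inv_arr B (\<theta> (Src B f)))"
      by (simp add: rules functorsD[OF v])
    also have "\<dots> = FArr v f"
      unfolding nat[OF f, symmetric] by (simp add: rules)
    finally show "FArr (p \<circ>\<^sub>F d) f = FArr v f" .
  qed
  ultimately show ?thesis using d by blast
qed

section \<open>Retracts\<close>

lemma retract_isofibration:
  assumes F: "F \<in> functors A B" and i: "i \<in> functors A C" and p: "p \<in> functors C B"
    and s: "s \<in> functors C A" and pi: "p \<circ>\<^sub>F i = F" and si: "s \<circ>\<^sub>F i = id_fun A" and Fs: "F \<circ>\<^sub>F s = p"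
    and fib: "isofibration p"
  shows "isofibration F"
proof (rule isofibrationI[OF F])
  fix x \<phi> assume x: "x \<in> Obj A" and \<phi>: "iso B \<phi>" "Src B \<phi> = FObj F x"
  have "FObj p (FObj i x) = FObj F x"
    using arg_cong[OF pi, of "\<lambda>F. FObj F x"] x by (simp add: functorsD(1)[OF i])
  then obtain \<psi> where \<psi>: "iso C \<psi>" "Src C \<psi> = FObj i x" "FArr p \<psi> = \<phi>"
    using isofibrationE[OF fib p functorsD(5)[OF i x] \<phi>(1)] \<phi>(2) by metis
  have "FObj s (FObj i x) = x"
    using arg_cong[OF si, of "\<lambda>F. FObj F x"] x by (simp add: functorsD(1)[OF i])
  moreover have "FArr F (FArr s \<psi>) = \<phi>"
    using arg_cong[OF Fs, of "\<lambda>F. FArr F \<psi>"] \<psi> by (simp add: functorsD(1)[OF s] inv_arr)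
  ultimately show "\<exists>\<psi>. iso A \<psi> \<and> Src A \<psi> = x \<and> FArr F \<psi> = \<phi>"
    using functor_iso(1)[OF s \<psi>(1)] \<psi> by (intro exI[of _ "FArr s \<psi>"]) (simp add: functorsD[OF s] inv_arr)
qed

lemma retract_trivial_fibration:
  assumes F: "F \<in> functors A B" and i: "i \<in> functors A C" and p: "p \<in> functors C B"
    and s: "s \<in> functors C A" and pi: "p \<circ>\<^sub>F i = F" and si: "s \<circ>\<^sub>F i = id_fun A" and Fs: "F \<circ>\<^sub>F s = p"
    and ff: "fully_faithful p" and surj: "surjective_on_objects p"
  shows "fully_faithful F" "surjective_on_objects F"
proof -
  have pi_obj: "FObj p (FObj i x) = FObj F x" if "x \<in> Obj A" for x
    using arg_cong[OF pi, of "\<lambda>F. FObj F x"] that by (simp add: functorsD(1)[OF i])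
  have pi_arr: "FArr p (FArr i f) = FArr F f" if "f \<in> Arr A" for f
    using arg_cong[OF pi, of "\<lambda>F. FArr F f"] that by (simp add: functorsD(1)[OF i])
  have si_obj: "FObj s (FObj i x) = x" if "x \<in> Obj A" for x
    using arg_cong[OF si, of "\<lambda>F. FObj F x"] that by (simp add: functorsD(1)[OF i])
  have si_arr: "FArr s (FArr i f) = f" if "f \<in> Arr A" for f
    using arg_cong[OF si, of "\<lambda>F. FArr F f"] that by (simp add: functorsD(1)[OF i])
  have Fs_obj: "FObj F (FObj s x) = FObj p x" if "x \<in> Obj C" for x
    using arg_cong[OF Fs, of "\<lambda>F. FObj F x"] that by (simp add: functorsD(1)[OF s])
  have Fs_arr: "FArr F (FArr s f) = FArr p f" if "f \<in> Arr C" for f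
    using arg_cong[OF Fs, of "\<lambda>F. FArr F f"] that by (simp add: functorsD(1)[OF s])
  show "fully_faithful F"
  proof (rule fully_faithfulI[OF F])
    fix f g assume fg: "f \<in> Arr A" "g \<in> Arr A" "Src A f = Src A g" "Tgt A f = Tgt A g" "FArr F f = FArr F g"
    then have "FArr i f = FArr i g"
      by (intro faithfulD[OF ff p]) (simp_all add: functorsD[OF i] pi_arr)
    then show "f = g" using fg si_arr by metis
  next
    fix x y \<beta> assume xy: "x \<in> Obj A" "y \<in> Obj A"
      and \<beta>: "\<beta> \<in> Arr B" "Src B \<beta> = FObj F x" "Tgt B \<beta> = FObj F y"
    then obtain f where f: "f \<in> Arr C" "Src C f = FObj i x" "Tgt C f = FObj i y" "FArr p f = \<beta>"
      using fullD[OF ff p, of "FObj i x" "FObj i y" \<beta>] by (auto simp: pi_obj functorsD(5)[OF i])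
    show "\<exists>f \<in> Arr A. Src A f = x \<and> Tgt A f = y \<and> FArr F f = \<beta>"
      using f xy by (intro bexI[of _ "FArr s f"]) (simp_all add: functorsD[OF s] si_obj Fs_arr)
  qed
  have "b \<in> FObj F ` Obj A" if b: "b \<in> Obj B" for b
  proof -
    obtain c where "c \<in> Obj C" "FObj p c = b"
      using surjective_on_objectsE[OF surj p b] .
    then show ?thesis by (intro image_eqI[of _ _ "FObj s c"]) (simp_all add: Fs_obj functorsD(5)[OF s])
  qed
  then show "surjective_on_objects F"
    by (auto simp: surjective_on_objects_def functorsD[OF F])
qed

lemma retract_injective:
  assumes j: "j \<in> functors A B" and i: "i \<in> functors A C" and d: "d \<in> functors B C"
    and dj: "d \<circ>\<^sub>F j = i" and inj: "injective_on_objects i"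
  shows "injective_on_objects j"
  unfolding injective_on_objects_def functorsD(1)[OF j]
proof (rule inj_onI)
  fix x y assume xy: "x \<in> Obj A" "y \<in> Obj A" "FObj j x = FObj j y"
  have "FObj d (FObj j x) = FObj i x" if "x \<in> Obj A" for x
    using arg_cong[OF dj, of "\<lambda>F. FObj F x"] that by (simp add: functorsD(1)[OF j])
  from this[OF xy(1)] this[OF xy(2)] xy inj show "x = y"
    by (simp add: injective_on_objects_def functorsD(1)[OF i] inj_on_def)
qed

lemma retract_equivalence:
  assumes j: "j \<in> functors A B" and i: "i \<in> functors A C" and p: "p \<in> functors C B"
    and d: "d \<in> functors B C" and pi: "p \<circ>\<^sub>F i = j" and dj: "d \<circ>\<^sub>F j = i" and pd: "p \<circ>\<^sub>F d = id_fun B"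
    and eq: "equivalence_of_categories i"
  shows "equivalence_of_categories j"
proof -
  have ff: "fully_faithful i" and eso: "essentially_surjective i"
    using eq equivalence_iff_ff_eso[OF i] by auto
  have pi_obj: "FObj p (FObj i x) = FObj j x" if "x \<in> Obj A" for x
    using arg_cong[OF pi, of "\<lambda>F. FObj F x"] that by (simp add: functorsD(1)[OF i])
  have pi_arr: "FArr p (FArr i f) = FArr j f" if "f \<in> Arr A" for f
    using arg_cong[OF pi, of "\<lambda>F. FArr F f"] that by (simp add: functorsD(1)[OF i])
  have dj_obj: "FObj d (FObj j x) = FObj i x" if "x \<in> Obj A" for x
    using arg_cong[OF dj, of "\<lambda>F. FObj F x"] that by (simp add: functorsD(1)[OF j])
  have dj_arr: "FArr d (FArr j f) = FArr i f" if "f \<in> Arr A" for f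
    using arg_cong[OF dj, of "\<lambda>F. FArr F f"] that by (simp add: functorsD(1)[OF j])
  have pd_obj: "FObj p (FObj d x) = x" if "x \<in> Obj B" for x
    using arg_cong[OF pd, of "\<lambda>F. FObj F x"] that by (simp add: functorsD(1)[OF d])
  have pd_arr: "FArr p (FArr d f) = f" if "f \<in> Arr B" for f
    using arg_cong[OF pd, of "\<lambda>F. FArr F f"] that by (simp add: functorsD(1)[OF d])
  have "fully_faithful j"
  proof (rule fully_faithfulI[OF j])
    fix f g assume fg: "f \<in> Arr A" "g \<in> Arr A" "Src A f = Src A g" "Tgt A f = Tgt A g" "FArr j f = FArr j g"
    show "f = g"
      using fg dj_arr by (intro faithfulD[OF ff i]) metis+
  next
    fix x y \<beta> assume xy: "x \<in> Obj A" "y \<in> Obj A"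
      and \<beta>: "\<beta> \<in> Arr B" "Src B \<beta> = FObj j x" "Tgt B \<beta> = FObj j y"
    then obtain f where f: "f \<in> Arr A" "Src A f = x" "Tgt A f = y" "FArr i f = FArr d \<beta>"
      using fullD[OF ff i xy, of "FArr d \<beta>"] by (auto simp: dj_obj functorsD[OF d])
    then have "FArr j f = \<beta>" using pi_arr[of f] pd_arr[OF \<beta>(1)] by simp
    with f show "\<exists>f \<in> Arr A. Src A f = x \<and> Tgt A f = y \<and> FArr j f = \<beta>" by blast
  qed
  moreover have "essentially_surjective j"
    unfolding essentially_surjective_def functorsD(1,2)[OF j]
  proof
    fix b assume b: "b \<in> Obj B"
    obtain a \<phi> where a: "a \<in> Obj A" and \<phi>: "iso C \<phi>" "Src C \<phi> = FObj i a" "Tgt C \<phi> = FObj d b"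
      using eso functorsD(5)[OF d b] unfolding essentially_surjective_def functorsD(1,2)[OF i] by blast
    then show "\<exists>a \<in> Obj A. \<exists>\<phi>. iso B \<phi> \<and> Src B \<phi> = FObj j a \<and> Tgt B \<phi> = b"
      using functor_iso(1)[OF p \<phi>(1)] b
      by (intro bexI[of _ a] exI[of _ "FArr p \<phi>"]) (simp_all add: functorsD[OF p] inv_arr pi_obj pd_obj)
  qed
  ultimately show ?thesis using equivalence_iff_ff_eso[OF j] by blast
qed

section \<open>Induced categories\<close>

text \<open>
  The category that makes \<open>\<pi> : X \<rightarrow> Obj B\<close> the object map of a fully faithful functor to \<open>B\<close>. The
  encoding \<open>e\<close> of triples serves to keep the arrows in the carrier type of small categories.
\<close>

definition induced_cat :: "('x \<times> 'a \<times> 'x \<Rightarrow> 'b) \<Rightarrow> ('o, 'a) cat \<Rightarrow> 'x set \<Rightarrow> ('x \<Rightarrow> 'o) \<Rightarrow> ('x, 'b) cat" where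
  "induced_cat e B X \<pi> = \<lparr>Obj = X,
     Arr = e ` {(x, f, y). x \<in> X \<and> y \<in> X \<and> f \<in> hom B (\<pi> x) (\<pi> y)},
     Src = (\<lambda>f. fst (inv e f)), Tgt = (\<lambda>f. snd (snd (inv e f))),
     Ide = (\<lambda>x. e (x, Ide B (\<pi> x), x)),
     Comp = (\<lambda>g f. e (fst (inv e f), fst (snd (inv e g)) \<cdot>\<^bsub>B\<^esub> fst (snd (inv e f)), snd (snd (inv e g))))\<rparr>"

lemma induced_cat:
  assumes e: "inj e" and B: "category B" and \<pi>: "\<And>x. x \<in> X \<Longrightarrow> \<pi> x \<in> Obj B"
  defines "q \<equiv> mk_functor (induced_cat e B X \<pi>) B \<pi> (\<lambda>f. fst (snd (inv e f)))"
  shows "q \<in> functors (induced_cat e B X \<pi>) B" "fully_faithful q"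
proof -
  note inv = inv_f_f[OF e]
  have C: "category (induced_cat e B X \<pi>)"
    using B by unfold_locales (auto simp: induced_cat_def inv \<pi> hom_def category_rules)
  show q: "q \<in> functors (induced_cat e B X \<pi>) B"
    unfolding q_def by (rule mk_functor[OF C B]) (auto simp: induced_cat_def inv \<pi> hom_def)
  show "fully_faithful q"
  proof (rule fully_faithfulI[OF q])
    fix f g assume "f \<in> Arr (induced_cat e B X \<pi>)" "g \<in> Arr (induced_cat e B X \<pi>)"
      "Src (induced_cat e B X \<pi>) f = Src (induced_cat e B X \<pi>) g"
      "Tgt (induced_cat e B X \<pi>) f = Tgt (induced_cat e B X \<pi>) g" "FArr q f = FArr q g"
    then show "f = g" by (auto simp: q_def) (auto simp: induced_cat_def inv)
  next
    fix x y \<beta> assume "x \<in> Obj (induced_cat e B X \<pi>)" "y \<in> Obj (induced_cat e B X \<pi>)"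
      and "\<beta> \<in> Arr B" "Src B \<beta> = FObj q x" "Tgt B \<beta> = FObj q y"
    then have "e (x, \<beta>, y) \<in> Arr (induced_cat e B X \<pi>)" "FArr q (e (x, \<beta>, y)) = \<beta>"
      by (simp_all add: q_def) (simp_all add: induced_cat_def inv hom_def mk_functor_def)
    then show "\<exists>f \<in> Arr (induced_cat e B X \<pi>). Src (induced_cat e B X \<pi>) f = x \<and>
        Tgt (induced_cat e B X \<pi>) f = y \<and> FArr q f = \<beta>"
      by (intro bexI[of _ "e (x, \<beta>, y)"]) (simp_all add: induced_cat_def inv)
  qed
qed

abbreviation smaller :: "'x set \<Rightarrow> 'y set \<Rightarrow> bool" where
  "smaller A B \<equiv> (card_of A, card_of B) \<in> ordLess"

lemma finite_smaller: "finite A \<Longrightarrow> infinite B \<Longrightarrow> smaller A B"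
  by (meson card_of_Well_order card_of_ordLeq_finite not_ordLeq_iff_ordLess)

lemma smaller_image: "smaller A C \<Longrightarrow> smaller (f ` A) C"
  using card_of_image ordLeq_ordLess_trans by blast

lemma smaller_subset: "smaller A C \<Longrightarrow> B \<subseteq> A \<Longrightarrow> smaller B C"
  using card_of_mono1 ordLeq_ordLess_trans by blast

lemma smaller_Times:
  assumes C: "infinite C" and A: "smaller A C" and B: "smaller B C"
  shows "smaller (A \<times> B) C"
proof (cases "infinite (A \<times> B)")
  case True
  then have ne: "A \<noteq> {}" "B \<noteq> {}" by auto
  show ?thesis
  proof (cases "(card_of A, card_of B) \<in> ordLeq")
    case True
    have "infinite B"
      using \<open>infinite (A \<times> B)\<close> True card_of_ordLeq_finite by blast
    then have "(card_of (A \<times> B), card_of B) \<in> ordIso"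
      using card_of_Times_infinite[OF _ ne(1) True] by simp
    then show ?thesis using B by (rule ordIso_ordLess_trans)
  next
    case False
    then have le: "(card_of B, card_of A) \<in> ordLeq"
      using ordLeq_total[OF card_of_Well_order[of A] card_of_Well_order[of B]] by simp
    have "infinite A"
      using \<open>infinite (A \<times> B)\<close> le card_of_ordLeq_finite by blast
    then have "(card_of (A \<times> B), card_of A) \<in> ordIso"
      using card_of_Times_infinite[OF _ ne(2) le] by simp
    then show ?thesis using A by (rule ordIso_ordLess_trans)
  qed
next
  case False
  then show ?thesis using finite_smaller[OF _ C] by blast
qed

lemma infinite_pairing:
  assumes "infinite (UNIV :: 'u set)"
  obtains pr :: "'u \<times> 'u \<Rightarrow> 'u" where "inj pr"
proof -
  have "(card_of (UNIV \<times> UNIV :: ('u \<times> 'u) set), card_of (UNIV :: 'u set)) \<in> ordLeq"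
    using card_of_Times_same_infinite[OF assms] ordIso_iff_ordLeq by blast
  then show ?thesis using that card_of_ordLeq[of "UNIV \<times> UNIV :: ('u \<times> 'u) set" "UNIV :: 'u set"] by auto
qed

section \<open>Factorisations\<close>

text \<open>
  Both cases, all small categories and all small groupoids, are treated at once: each class is
  closed under passing to a small category that maps fully faithfully to a member.
\<close>

locale category_universe =
  fixes \<kappa> :: "'k set" and S :: "('u, 'u) cat set"
  assumes infinite_carrier: "infinite (UNIV :: 'u set)" and infinite_bound: "infinite \<kappa>"
    and S_cases: "S = {A. category A \<and> small_cat \<kappa> A} \<or> S = {A. groupoid A \<and> small_cat \<kappa> A}"
begin

lemma S_category: "A \<in> S \<Longrightarrow> category A"
  using S_cases by (auto simp: groupoid_def)

lemma S_small: "A \<in> S \<Longrightarrow> smaller (Obj A) \<kappa>" "A \<in> S \<Longrightarrow> smaller (Arr A) \<kappa>"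
  using S_cases by (auto simp: small_cat_def)

lemma S_fully_faithful:
  assumes q: "q \<in> functors C B" "fully_faithful q" and B: "B \<in> S" and C: "small_cat \<kappa> C"
  shows "C \<in> S"
  using S_cases B C fully_faithful_groupoid[OF q(2,1)] functorsD(3)[OF q(1)] by auto

text \<open>
  The interface to induced categories: full faithfulness and the object map determine everything
  that follows, and the encoding of arrows stays hidden.
\<close>

lemma induced_category:
  fixes X :: "'u set"
  assumes B: "B \<in> S" and X: "smaller X \<kappa>" and \<pi>: "\<And>x. x \<in> X \<Longrightarrow> \<pi> x \<in> Obj B"
  obtains C q where "C \<in> S" "q \<in> functors C B" "fully_faithful q" "Obj C = X"
    "\<And>x. x \<in> X \<Longrightarrow> FObj q x = \<pi> x"
proof -
  obtain pr :: "'u \<times> 'u \<Rightarrow> 'u" where pr: "inj pr" using infinite_pairing[OF infinite_carrier] .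
  define e where "e = (\<lambda>(x, f, y). pr (x, pr (f, y)))"
  have e: "inj e" by (rule injI) (auto simp: e_def dest!: injD[OF pr])
  define C where "C = induced_cat e B X \<pi>"
  define q where "q = mk_functor C B \<pi> (\<lambda>f. fst (snd (inv e f)))"
  have q: "q \<in> functors C B" "fully_faithful q"
    using induced_cat[OF e S_category[OF B] \<pi>] by (simp_all add: q_def C_def)
  have C_obj: "Obj C = X" by (simp add: C_def induced_cat_def)
  have "smaller (X \<times> Arr B \<times> X) \<kappa>"
    by (intro smaller_Times infinite_bound X S_small(2)[OF B])
  moreover have "Arr C \<subseteq> e ` (X \<times> Arr B \<times> X)"
    by (auto simp: C_def induced_cat_def hom_def)
  ultimately have "smaller (Arr C) \<kappa>" using smaller_image smaller_subset by metis
  then have "small_cat \<kappa> C" using X by (simp add: small_cat_def C_obj)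
  then have "C \<in> S" by (rule S_fully_faithful[OF q B])
  moreover have "FObj q x = \<pi> x" if "x \<in> X" for x
    using that by (simp add: q_def C_obj)
  ultimately show ?thesis using that q C_obj by blast
qed

text \<open>
  Induced from the terminal category along the map from a set of two points.
\<close>

lemma chaotic_category:
  obtains Z z0 z1 where "Z \<in> S" "chaotic Z" "z0 \<in> Obj Z" "z1 \<in> Obj Z" "z0 \<noteq> z1"
proof -
  obtain z0 :: 'u where True by blast
  obtain z1 where z1: "z1 \<noteq> z0" using ex_new_if_finite[OF infinite_carrier, of "{z0}"] by auto
  define T :: "('u, 'u) cat" where "T = \<lparr>Obj = {z0}, Arr = {z0}, Src = (\<lambda>_. z0), Tgt = (\<lambda>_. z0),
    Ide = (\<lambda>_. z0), Comp = (\<lambda>_ _. z0)\<rparr>"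
  have "category T" by unfold_locales (auto simp: T_def)
  then have "groupoid T" by (auto simp: groupoid_def iso_def hom_def T_def)
  moreover have "small_cat \<kappa> T"
    by (simp add: small_cat_def T_def finite_smaller infinite_bound)
  ultimately have T: "T \<in> S" using S_cases \<open>category T\<close> by auto
  have "smaller {z0, z1} \<kappa>" "z0 \<in> Obj T"
    by (simp_all add: finite_smaller infinite_bound T_def)
  then obtain Z q where Z: "Z \<in> S" and q: "q \<in> functors Z T" "fully_faithful q" and Z_obj: "Obj Z = {z0, z1}"
    using induced_category[OF T, of "{z0, z1}" "\<lambda>_. z0"] by metis
  have "chaotic Z"
    unfolding chaotic_def
  proof (intro ballI)
    fix x y assume xy: "x \<in> Obj Z" "y \<in> Obj Z"
    have "Arr T = {z0}" "Src T f = FObj q x" "Tgt T f = FObj q y" for f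
      using functorsD(5)[OF q(1)] xy by (auto simp: T_def)
    then have "\<exists>f \<in> Arr Z. Src Z f = x \<and> Tgt Z f = y \<and> FArr q f = z0"
      by (intro fullD[OF q(2,1) xy]) simp_all
    then have "\<exists>f. f \<in> hom Z x y" unfolding hom_def by blast
    moreover have "f = g" if "f \<in> hom Z x y" "g \<in> hom Z x y" for f g
    proof (rule faithfulD[OF q(2,1)])
      show "f \<in> Arr Z" "g \<in> Arr Z" "Src Z f = Src Z g" "Tgt Z f = Tgt Z g"
        using that by (simp_all add: hom_def)
      then have "FArr q f \<in> Arr T" "FArr q g \<in> Arr T" by (simp_all add: functorsD(6)[OF q(1)])
      then show "FArr q f = FArr q g" by (simp add: T_def)
    qed
    ultimately show "\<exists>!f. f \<in> hom Z x y" by blast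
  qed
  with Z Z_obj z1 show ?thesis by (intro that[of Z z0 z1]) auto
qed

text \<open>
  The middle category has the objects of \<open>A\<close> and those of \<open>B\<close> side by side, and the arrows of
  \<open>B\<close> between their images: a mapping cylinder.
\<close>

lemma factor_cofibration_trivial_fibration:
  assumes AB: "A \<in> S" "B \<in> S" and f: "f \<in> functors A B"
  obtains C i p where "C \<in> S" "i \<in> functors A C" "injective_on_objects i"
    "p \<in> functors C B" "fully_faithful p" "surjective_on_objects p" "p \<circ>\<^sub>F i = f"
proof -
  obtain pr :: "'u \<times> 'u \<Rightarrow> 'u" where pr: "inj pr" using infinite_pairing[OF infinite_carrier] .
  note inv = inv_f_f[OF pr]
  obtain z0 :: 'u where True by blast
  obtain z1 where z1: "z1 \<noteq> z0" using ex_new_if_finite[OF infinite_carrier, of "{z0}"] by auto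
  \<comment> \<open>The tags \<open>z0\<close> and \<open>z1\<close> keep the objects of \<open>A\<close> and \<open>B\<close> apart.\<close>
  define X where "X = (\<lambda>a. pr (z0, a)) ` Obj A \<union> (\<lambda>b. pr (z1, b)) ` Obj B"
  define \<pi> where "\<pi> x = (case inv pr x of (t, y) \<Rightarrow> if t = z0 then FObj f y else y)" for x
  have "smaller X \<kappa>"
    unfolding X_def
    by (intro card_of_Un_ordLess_infinite infinite_bound smaller_image S_small AB)
  moreover have "\<pi> x \<in> Obj B" if "x \<in> X" for x
    using that z1 by (auto simp: X_def \<pi>_def inv functorsD(5)[OF f])
  ultimately obtain C p where C: "C \<in> S" and p: "p \<in> functors C B" "fully_faithful p"
    and C_obj: "Obj C = X" and p_obj: "\<And>x. x \<in> X \<Longrightarrow> FObj p x = \<pi> x"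
    using induced_category[OF AB(2), of X \<pi>] by metis
  have "b \<in> FObj p ` Obj C" if "b \<in> Obj B" for b
    using that z1 by (intro image_eqI[of _ _ "pr (z1, b)"]) (auto simp: C_obj p_obj X_def \<pi>_def inv)
  then have surj: "surjective_on_objects p"
    by (auto simp: surjective_on_objects_def functorsD[OF p(1)])
  have s: "pr (z0, a) \<in> Obj C" "FObj p (pr (z0, a)) = FObj f a" if "a \<in> Obj A" for a
    using that by (simp_all add: C_obj p_obj X_def \<pi>_def inv)
  obtain i where i: "i \<in> functors A C" "p \<circ>\<^sub>F i = f" "\<And>a. a \<in> Obj A \<Longrightarrow> FObj i a = pr (z0, a)"
    using fully_faithful_lift[OF p(2,1) f, of "\<lambda>a. pr (z0, a)"] s by blast
  have "injective_on_objects i"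
    unfolding injective_on_objects_def functorsD(1)[OF i(1)]
    by (rule inj_onI) (simp add: i(3) inj_eq[OF pr])
  with C i p surj show ?thesis by (intro that)
qed

text \<open>
  The middle category \<open>P\<close> consists of an object \<open>a\<close> of \<open>A\<close> with an isomorphism \<open>\<phi>\<close> out of \<open>f a\<close>, and
  \<open>p\<close> takes the target of \<open>\<phi>\<close>. An arrow of this mapping path category is an arrow of \<open>A\<close>, as
  its component in \<open>B\<close> is forced; hence \<open>P\<close> is induced along \<open>(a, \<phi>) \<mapsto> a\<close>, and \<open>p\<close> is the
  conjugate by the \<open>\<phi>\<close> of \<open>f\<close> after the projection \<open>q\<close> to \<open>A\<close>.
\<close>

lemma factor_trivial_cofibration_fibration:
  assumes AB: "A \<in> S" "B \<in> S" and f: "f \<in> functors A B"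
  obtains P i p where "P \<in> S" "i \<in> functors A P" "injective_on_objects i"
    "equivalence_of_categories i" "p \<in> functors P B" "isofibration p" "p \<circ>\<^sub>F i = f"
proof -
  note cat = functorsD(3,4)[OF f]
  obtain pr :: "'u \<times> 'u \<Rightarrow> 'u" where pr: "inj pr" using infinite_pairing[OF infinite_carrier] .
  note inv = inv_f_f[OF pr]
  define X where "X = pr ` {(a, \<phi>). a \<in> Obj A \<and> iso B \<phi> \<and> Src B \<phi> = FObj f a}"
  have "smaller (pr ` (Obj A \<times> Arr B)) \<kappa>"
    by (intro smaller_image smaller_Times infinite_bound S_small AB)
  then have "smaller X \<kappa>"
    by (rule smaller_subset) (auto simp: X_def inv_arr)
  moreover have "fst (inv pr x) \<in> Obj A" if "x \<in> X" for x
    using that by (auto simp: X_def inv)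
  ultimately obtain P q where P: "P \<in> S" and q: "q \<in> functors P A" "fully_faithful q"
    and P_obj: "Obj P = X" and q_obj: "\<And>x. x \<in> X \<Longrightarrow> FObj q x = fst (inv pr x)"
    using induced_category[OF AB(1), of X "\<lambda>x. fst (inv pr x)"] by metis
  note catP = S_category[OF P]
  have X: "pr (a, \<phi>) \<in> X" if "a \<in> Obj A" "iso B \<phi>" "Src B \<phi> = FObj f a" for a \<phi>
    using that by (auto simp: X_def)
  have XE: "\<exists>a \<phi>. x = pr (a, \<phi>) \<and> a \<in> Obj A \<and> iso B \<phi> \<and> Src B \<phi> = FObj f a" if "x \<in> X" for x
    using that by (auto simp: X_def)
  have base: "pr (a, Ide B (FObj f a)) \<in> X" if "a \<in> Obj A" for a
    using that cat by (intro X) (simp_all add: iso_Ide functorsD(5)[OF f] category_rules)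
  have s: "pr (a, Ide B (FObj f a)) \<in> Obj P"
    "FObj q (pr (a, Ide B (FObj f a))) = FObj (id_fun A) a" if "a \<in> Obj A" for a
    using base[OF that] that by (simp_all add: P_obj q_obj inv)
  obtain i where i: "i \<in> functors A P" and qi: "q \<circ>\<^sub>F i = id_fun A"
    and i_obj: "\<And>a. a \<in> Obj A \<Longrightarrow> FObj i a = pr (a, Ide B (FObj f a))"
    using fully_faithful_lift[OF q(2,1) id_fun[OF cat(1)], of "\<lambda>a. pr (a, Ide B (FObj f a))"] s by blast
  have qi_arr: "FArr q (FArr i h) = h" if "h \<in> Arr A" for h
    using arg_cong[OF qi, of "\<lambda>F. FArr F h"] that by (simp add: functorsD(1)[OF i])
  have qi_obj: "FObj q (FObj i a) = a" if "a \<in> Obj A" for a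
    using s[OF that] that by (simp add: i_obj)
  have inj: "injective_on_objects i"
    unfolding injective_on_objects_def functorsD(1)[OF i] using qi_obj by (rule inj_on_inverseI)
  have "fully_faithful i"
  proof (rule fully_faithfulI[OF i])
    fix h h' assume "h \<in> Arr A" "h' \<in> Arr A" "FArr i h = FArr i h'"
    then show "h = h'" using qi_arr by metis
  next
    fix x y \<beta> assume xy: "x \<in> Obj A" "y \<in> Obj A"
      and \<beta>: "\<beta> \<in> Arr P" "Src P \<beta> = FObj i x" "Tgt P \<beta> = FObj i y"
    have "FArr i (FArr q \<beta>) = \<beta>"
      by (rule faithfulD[OF q(2,1)]) (simp_all add: xy \<beta> functorsD[OF i] functorsD[OF q(1)] qi_arr qi_obj)
    with xy \<beta> show "\<exists>h \<in> Arr A. Src A h = x \<and> Tgt A h = y \<and> FArr i h = \<beta>"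
      by (intro bexI[of _ "FArr q \<beta>"]) (simp_all add: functorsD[OF q(1)] qi_obj)
  qed
  moreover have "essentially_surjective i"
    unfolding essentially_surjective_def functorsD(1,2)[OF i]
  proof
    fix x assume x: "x \<in> Obj P"
    let ?a = "FObj q x"
    have a: "?a \<in> Obj A" using x by (simp add: functorsD[OF q(1)])
    obtain \<phi> where "iso P \<phi>" "Src P \<phi> = FObj i ?a" "Tgt P \<phi> = x"
      using fully_faithful_lift_iso[OF q(2,1) functorsD(5)[OF i a] x, of "Ide A ?a"] a cat
      by (auto simp: iso_Ide category_rules qi_obj)
    with a show "\<exists>a \<in> Obj A. \<exists>\<phi>. iso P \<phi> \<and> Src P \<phi> = FObj i a \<and> Tgt P \<phi> = x" by blast
  qed
  ultimately have eq: "equivalence_of_categories i" using equivalence_iff_ff_eso[OF i] by blast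
  define \<theta> where "\<theta> x = snd (inv pr x)" for x
  have fq: "f \<circ>\<^sub>F q \<in> functors P B" by (rule comp_fun[OF q(1) f])
  have \<theta>: "iso B (\<theta> x)" "Src B (\<theta> x) = FObj (f \<circ>\<^sub>F q) x" if "x \<in> Obj P" for x
    using XE[of x] that by (auto simp: P_obj \<theta>_def inv q_obj functorsD(1)[OF q(1)])
  define p where "p = conj_fun (f \<circ>\<^sub>F q) \<theta>"
  note conj = conj_fun[OF fq, of \<theta>, OF \<theta>, folded p_def]
  have p: "p \<in> functors P B" using conj(1) by simp
  have p_obj: "FObj p x = Tgt B (\<theta> x)" if "x \<in> Obj P" for x
    using conj(2) that by simp
  have p_arr: "FArr p h = \<theta> (Tgt P h) \<cdot>\<^bsub>B\<^esub> (FArr f (FArr q h) \<cdot>\<^bsub>B\<^esub> inv_arr B (\<theta> (Src P h)))"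
    if "h \<in> Arr P" for h
    using that by (subst conj(3)) (simp_all add: functorsD(1)[OF q(1)])
  have "p \<circ>\<^sub>F i = f"
  proof (rule functor_eqI[OF comp_fun[OF i p] f])
    fix h assume h: "h \<in> Arr A"
    have st: "Src A h \<in> Obj A" "Tgt A h \<in> Obj A" using h cat by (simp_all add: category_rules)
    have "\<theta> (FObj i a) = Ide B (FObj f a)" if "a \<in> Obj A" for a
      using that by (simp add: i_obj \<theta>_def inv)
    with h st cat show "FArr (p \<circ>\<^sub>F i) h = FArr f h"
      by (simp add: functorsD[OF i] p_arr qi_arr functorsD[OF f] inv_arr_Ide category_rules)
  qed
  moreover have "isofibration p"
  proof (rule isofibrationI[OF p])
    fix x \<psi> assume x: "x \<in> Obj P" and \<psi>: "iso B \<psi>" "Src B \<psi> = FObj p x"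
    obtain a \<phi> where a: "x = pr (a, \<phi>)" "a \<in> Obj A" and \<phi>: "iso B \<phi>" "Src B \<phi> = FObj f a"
      using XE[of x] x by (auto simp: P_obj)
    have Tgt: "Tgt B \<phi> = Src B \<psi>" using \<psi>(2) p_obj[OF x] by (simp add: a \<theta>_def inv)
    define y where "y = pr (a, \<psi> \<cdot>\<^bsub>B\<^esub> \<phi>)"
    have y: "y \<in> Obj P"
      using a \<phi> \<psi>(1) Tgt cat unfolding P_obj y_def
      by (intro X) (simp_all add: iso_Comp inv_arr category_rules)
    have q_xy: "FObj q x = a" "FObj q y = a"
      using x y by (simp_all add: P_obj q_obj) (simp_all add: a y_def inv)
    obtain h where h: "iso P h" "Src P h = x" "Tgt P h = y" "FArr q h = Ide A a"
      using fully_faithful_lift_iso[OF q(2,1) x y, of "Ide A a"] a cat q_xy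
      by (auto simp: iso_Ide category_rules)
    have "FArr p h = (\<psi> \<cdot>\<^bsub>B\<^esub> \<phi>) \<cdot>\<^bsub>B\<^esub> (FArr f (Ide A a) \<cdot>\<^bsub>B\<^esub> inv_arr B \<phi>)"
      using h by (simp add: p_arr inv_arr) (simp add: \<theta>_def y_def a inv)
    also have "\<dots> = \<psi>"
      using \<phi> \<psi>(1) Tgt cat a
      by (simp add: functorsD[OF f] inv_arr inv_arr_cancel category_rules flip: \<phi>(2))
    finally show "\<exists>\<chi>. iso P \<chi> \<and> Src P \<chi> = x \<and> FArr p \<chi> = \<psi>" using h by blast
  qed
  ultimately show ?thesis using P i inj eq p by (intro that)
qed

section \<open>The model structure\<close>

abbreviation K :: "(('u, 'u) cat, ('u, 'u, 'u, 'u) cfunctor) cat" where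
  "K \<equiv> category_of_categories S"

lemma K_simps [simp]:
  "Obj K = S" "Src K = FDom" "Tgt K = FCod" "Ide K = id_fun" "Comp K = comp_fun"
  by (simp_all add: category_of_categories_def)

lemma Arr_K_iff: "f \<in> Arr K \<longleftrightarrow> FDom f \<in> S \<and> FCod f \<in> S \<and> f \<in> functors (FDom f) (FCod f)"
  by (auto simp: category_of_categories_def functorsD(1,2))

lemma Arr_KI: "\<lbrakk>A \<in> S; B \<in> S; f \<in> functors A B\<rbrakk> \<Longrightarrow> f \<in> Arr K"
  by (auto simp: category_of_categories_def)

lemma Arr_KE:
  assumes "f \<in> Arr K"
  obtains A B where "A \<in> S" "B \<in> S" "f \<in> functors A B"
  using assms by (auto simp: category_of_categories_def)

lemma hom_K: "\<lbrakk>A \<in> S; B \<in> S\<rbrakk> \<Longrightarrow> hom K A B = functors A B"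
  by (auto simp: hom_def Arr_K_iff functorsD(1,2))

lemma category_K: "category K"
proof
  fix f g h
  show "f \<in> Arr K \<Longrightarrow> Src K f \<in> Obj K" "f \<in> Arr K \<Longrightarrow> Tgt K f \<in> Obj K"
    by (simp_all add: Arr_K_iff)
  show "x \<in> Obj K \<Longrightarrow> Ide K x \<in> Arr K" for x
    using S_category id_fun by (auto intro: Arr_KI)
  show "Src K (Ide K x) = x" "Tgt K (Ide K x) = x" for x by simp_all
  show "f \<in> Arr K \<Longrightarrow> f \<cdot>\<^bsub>K\<^esub> Ide K (Src K f) = f" "f \<in> Arr K \<Longrightarrow> Ide K (Tgt K f) \<cdot>\<^bsub>K\<^esub> f = f"
    using comp_id_fun[of f "FDom f" "FCod f"] id_comp_fun[of f "FDom f" "FCod f"]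
    by (simp_all add: Arr_K_iff)
  assume f: "f \<in> Arr K" and g: "g \<in> Arr K" and fg: "Tgt K f = Src K g"
  show "Src K (g \<cdot>\<^bsub>K\<^esub> f) = Src K f" "Tgt K (g \<cdot>\<^bsub>K\<^esub> f) = Tgt K g" by simp_all
  show "g \<cdot>\<^bsub>K\<^esub> f \<in> Arr K"
    using f g fg comp_fun[of f "FDom f" "FCod f" g "FCod g"] by (simp add: Arr_K_iff)
  assume "h \<in> Arr K" "Tgt K g = Src K h"
  with f g fg show "(h \<cdot>\<^bsub>K\<^esub> g) \<cdot>\<^bsub>K\<^esub> f = h \<cdot>\<^bsub>K\<^esub> (g \<cdot>\<^bsub>K\<^esub> f)"
    using comp_fun_assoc[of f "FDom f" "FCod f" g "FCod g" h "FCod h"] by (simp add: Arr_K_iff)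
qed

lemma iso_cofibration_iff:
  assumes j: "j \<in> Arr K"
  shows "iso_cofibration K j \<longleftrightarrow> injective_on_objects j"
proof
  obtain A B where AB: "A \<in> S" "B \<in> S" and f: "j \<in> functors A B" using Arr_KE[OF j] .
  {
    assume cof: "iso_cofibration K j"
    obtain Z z0 z1 where Z: "Z \<in> S" "chaotic Z" "z0 \<in> Obj Z" "z1 \<in> Obj Z" "z0 \<noteq> z1"
      using chaotic_category .
    have "inj_on (FObj j) (Obj A)"
    proof (rule injective_if_homotopy_extension[OF f S_category[OF Z(1)] Z(2-5)])
      fix g h assume "g \<in> functors B Z" "h \<in> functors (A \<times>\<^sub>C interval) Z" "h \<circ>\<^sub>F incl0 A = g \<circ>\<^sub>F j"
      then show "\<exists>k \<in> functors (B \<times>\<^sub>C interval) Z. k \<circ>\<^sub>F (j \<times>\<^sub>F id_fun interval) = h"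
        using cof Z(1) unfolding iso_cofibration_def functorsD(1,2)[OF f] K_simps by blast
    qed
    then show "injective_on_objects j" by (simp add: injective_on_objects_def functorsD(1)[OF f])
  }
  assume "injective_on_objects j"
  then have inj: "inj_on (FObj j) (Obj A)" by (simp add: injective_on_objects_def functorsD(1)[OF f])
  show "iso_cofibration K j"
    unfolding iso_cofibration_def functorsD(1,2)[OF f]
    using j injective_homotopy_extension[OF f inj] by blast
qed

definition weq where "weq = {F \<in> Arr K. equivalence_of_categories F}"
definition fib where "fib = {F \<in> Arr K. normally_cloven_isofibration F}"
definition cof where "cof = {F \<in> Arr K. iso_cofibration K F}"

lemma fib_iff: "f \<in> fib \<longleftrightarrow> f \<in> Arr K \<and> isofibration f"
  using normally_cloven_isofibration_iff by (auto simp: fib_def Arr_K_iff)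

lemma cof_iff: "f \<in> cof \<longleftrightarrow> f \<in> Arr K \<and> injective_on_objects f"
  using iso_cofibration_iff by (auto simp: cof_def)

lemma trivial_fib_iff:
  "f \<in> fib \<inter> weq \<longleftrightarrow> f \<in> Arr K \<and> fully_faithful f \<and> surjective_on_objects f"
  using trivial_fibration_iff[of f "FDom f" "FCod f"] by (auto simp: fib_iff weq_def Arr_K_iff)

lemma trivial_cof_iff:
  "f \<in> cof \<inter> weq \<longleftrightarrow> f \<in> Arr K \<and> injective_on_objects f \<and> equivalence_of_categories f"
  by (auto simp: cof_iff weq_def)

lemma has_lift_K:
  assumes "A \<in> S" "B \<in> S" "j \<in> functors A B" "X \<in> S" "Y \<in> S" "p \<in> functors X Y"
  shows "has_lift K j p \<longleftrightarrow> (\<forall>u \<in> functors A X. \<forall>v \<in> functors B Y. p \<circ>\<^sub>F u = v \<circ>\<^sub>F j \<longrightarrow>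
    (\<exists>d \<in> functors B X. d \<circ>\<^sub>F j = u \<and> p \<circ>\<^sub>F d = v))"
  using assms by (simp add: has_lift_def hom_K functorsD(1,2)[OF assms(3)] functorsD(1,2)[OF assms(6)])

lemma cof_lifts_trivial_fib:
  assumes j: "j \<in> cof" and p: "p \<in> fib \<inter> weq"
  shows "has_lift K j p"
proof -
  obtain A B where AB: "A \<in> S" "B \<in> S" "j \<in> functors A B" using j Arr_KE cof_iff by blast
  obtain X Y where XY: "X \<in> S" "Y \<in> S" "p \<in> functors X Y" using p Arr_KE trivial_fib_iff by blast
  show ?thesis
    using lift_cofibration_trivial_fibration[OF AB(3) _ XY(3)] j p
    unfolding has_lift_K[OF AB XY] cof_iff trivial_fib_iff by blast
qed

lemma trivial_cof_lifts_fib: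
  assumes j: "j \<in> cof \<inter> weq" and p: "p \<in> fib"
  shows "has_lift K j p"
proof -
  obtain A B where AB: "A \<in> S" "B \<in> S" "j \<in> functors A B" using j Arr_KE trivial_cof_iff by blast
  obtain X Y where XY: "X \<in> S" "Y \<in> S" "p \<in> functors X Y" using p Arr_KE fib_iff by blast
  show ?thesis
    using lift_trivial_cofibration_fibration[OF AB(3) _ _ XY(3)] j p
    unfolding has_lift_K[OF AB XY] trivial_cof_iff fib_iff by blast
qed

text \<open>
  The retract argument: a map with the right lifting property against its own left factor is
  a retract of its right factor, and dually.
\<close>

lemma retract_of_right_factor:
  assumes C: "A \<in> S" "B \<in> S" "C \<in> S" and f: "f \<in> functors A B"
    and i: "i \<in> functors A C" and p: "p \<in> functors C B" and fact: "p \<circ>\<^sub>F i = f"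
    and lift: "has_lift K i f"
  obtains s where "s \<in> functors C A" "s \<circ>\<^sub>F i = id_fun A" "f \<circ>\<^sub>F s = p"
proof -
  have "f \<circ>\<^sub>F id_fun A = p \<circ>\<^sub>F i" by (simp add: fact comp_id_fun[OF f])
  then show ?thesis
    using lift that id_fun[OF S_category[OF C(1)]] p
    unfolding has_lift_K[OF C(1,3) i C(1,2) f] by blast
qed

lemma retract_of_left_factor:
  assumes C: "A \<in> S" "B \<in> S" "C \<in> S" and f: "f \<in> functors A B"
    and i: "i \<in> functors A C" and p: "p \<in> functors C B" and fact: "p \<circ>\<^sub>F i = f"
    and lift: "has_lift K f p"
  obtains d where "d \<in> functors B C" "d \<circ>\<^sub>F f = i" "p \<circ>\<^sub>F d = id_fun B"
proof -
  have "p \<circ>\<^sub>F i = id_fun B \<circ>\<^sub>F f" by (simp add: fact id_comp_fun[OF f])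
  then show ?thesis
    using lift that id_fun[OF S_category[OF C(2)]] i
    unfolding has_lift_K[OF C(1,2) f C(3,2) p] by blast
qed

lemma fib_eq_rlp: "fib = rlp K (cof \<inter> weq)"
proof (rule set_eqI, rule iffI)
  fix f assume f: "f \<in> fib"
  then show "f \<in> rlp K (cof \<inter> weq)"
    using trivial_cof_lifts_fib by (simp add: rlp_def fib_iff)
next
  fix f assume f: "f \<in> rlp K (cof \<inter> weq)"
  then obtain A B where AB: "A \<in> S" "B \<in> S" and F: "f \<in> functors A B"
    using Arr_KE by (auto simp: rlp_def)
  obtain P i p where P: "P \<in> S" and i: "i \<in> functors A P" "injective_on_objects i"
      "equivalence_of_categories i" and p: "p \<in> functors P B" "isofibration p" and fact: "p \<circ>\<^sub>F i = f"
    using factor_trivial_cofibration_fibration[OF AB F] .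
  have "i \<in> cof \<inter> weq" unfolding trivial_cof_iff using i Arr_KI[OF AB(1) P] by blast
  then have "has_lift K i f" using f by (simp add: rlp_def)
  then obtain s where "s \<in> functors P A" "s \<circ>\<^sub>F i = id_fun A" "f \<circ>\<^sub>F s = p"
    using retract_of_right_factor[OF AB P F i(1) p(1) fact] by blast
  then have "isofibration f" using retract_isofibration[OF F i(1) p(1) _ fact] p(2) by blast
  then show "f \<in> fib" using Arr_KI[OF AB F] by (simp add: fib_iff)
qed

lemma trivial_fib_eq_rlp: "fib \<inter> weq = rlp K cof"
proof (rule set_eqI, rule iffI)
  fix f assume f: "f \<in> fib \<inter> weq"
  then show "f \<in> rlp K cof"
    using cof_lifts_trivial_fib trivial_fib_iff by (simp add: rlp_def)
next
  fix f assume f: "f \<in> rlp K cof"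
  then obtain A B where AB: "A \<in> S" "B \<in> S" and F: "f \<in> functors A B"
    using Arr_KE by (auto simp: rlp_def)
  obtain C i p where C: "C \<in> S" and i: "i \<in> functors A C" "injective_on_objects i"
      and p: "p \<in> functors C B" "fully_faithful p" "surjective_on_objects p" and fact: "p \<circ>\<^sub>F i = f"
    using factor_cofibration_trivial_fibration[OF AB F] .
  have "i \<in> cof" unfolding cof_iff using i Arr_KI[OF AB(1) C] by blast
  then have "has_lift K i f" using f by (simp add: rlp_def)
  then obtain s where "s \<in> functors C A" "s \<circ>\<^sub>F i = id_fun A" "f \<circ>\<^sub>F s = p"
    using retract_of_right_factor[OF AB C F i(1) p(1) fact] by blast
  then have "fully_faithful f" "surjective_on_objects f"
    using retract_trivial_fibration[OF F i(1) p(1) _ fact _ _ p(2,3)] by blast+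
  then show "f \<in> fib \<inter> weq" using Arr_KI[OF AB F] trivial_fib_iff by blast
qed

lemma cof_eq_llp: "cof = llp K (fib \<inter> weq)"
proof (rule set_eqI, rule iffI)
  fix f assume f: "f \<in> cof"
  then show "f \<in> llp K (fib \<inter> weq)"
    using cof_lifts_trivial_fib by (simp add: llp_def cof_iff)
next
  fix f assume f: "f \<in> llp K (fib \<inter> weq)"
  then obtain A B where AB: "A \<in> S" "B \<in> S" and F: "f \<in> functors A B"
    using Arr_KE by (auto simp: llp_def)
  obtain C i p where C: "C \<in> S" and i: "i \<in> functors A C" "injective_on_objects i"
      and p: "p \<in> functors C B" "fully_faithful p" "surjective_on_objects p" and fact: "p \<circ>\<^sub>F i = f"
    using factor_cofibration_trivial_fibration[OF AB F] .
  have "p \<in> fib \<inter> weq" unfolding trivial_fib_iff using p Arr_KI[OF C AB(2)] by blast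
  then have "has_lift K f p" using f by (simp add: llp_def)
  then obtain d where "d \<in> functors B C" "d \<circ>\<^sub>F f = i" "p \<circ>\<^sub>F d = id_fun B"
    using retract_of_left_factor[OF AB C F i(1) p(1) fact] by blast
  then have "injective_on_objects f" using retract_injective[OF F i(1)] i(2) by blast
  then show "f \<in> cof" using Arr_KI[OF AB F] by (simp add: cof_iff)
qed

lemma trivial_cof_eq_llp: "cof \<inter> weq = llp K fib"
proof (rule set_eqI, rule iffI)
  fix f assume f: "f \<in> cof \<inter> weq"
  then show "f \<in> llp K fib"
    using trivial_cof_lifts_fib trivial_cof_iff by (simp add: llp_def)
next
  fix f assume f: "f \<in> llp K fib"
  then obtain A B where AB: "A \<in> S" "B \<in> S" and F: "f \<in> functors A B"
    using Arr_KE by (auto simp: llp_def)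
  obtain P i p where P: "P \<in> S" and i: "i \<in> functors A P" "injective_on_objects i"
      "equivalence_of_categories i" and p: "p \<in> functors P B" "isofibration p" and fact: "p \<circ>\<^sub>F i = f"
    using factor_trivial_cofibration_fibration[OF AB F] .
  have "p \<in> fib" unfolding fib_iff using p Arr_KI[OF P AB(2)] by blast
  then have "has_lift K f p" using f by (simp add: llp_def)
  then obtain d where d: "d \<in> functors B P" "d \<circ>\<^sub>F f = i" "p \<circ>\<^sub>F d = id_fun B"
    using retract_of_left_factor[OF AB P F i(1) p(1) fact] by blast
  have "injective_on_objects f" using retract_injective[OF F i(1) d(1,2) i(2)] .
  moreover have "equivalence_of_categories f"
    using retract_equivalence[OF F i(1) p(1) d(1) fact d(2,3) i(3)] .
  ultimately show "f \<in> cof \<inter> weq" using Arr_KI[OF AB F] trivial_cof_iff by blast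
qed

lemma two_out_of_three_K: "two_out_of_three K weq"
  unfolding two_out_of_three_def
proof (intro ballI impI)
  fix f g assume f: "f \<in> Arr K" and g: "g \<in> Arr K" and fg: "Tgt K f = Src K g"
  have gf: "g \<circ>\<^sub>F f \<in> Arr K" using category.Comp_closed[OF category_K f g fg] by simp
  have F: "f \<in> functors (FDom f) (FCod f)" and G: "g \<in> functors (FCod f) (FCod g)"
    using f g fg by (simp_all add: Arr_K_iff)
  show "(f \<in> weq \<and> g \<in> weq \<longrightarrow> g \<cdot>\<^bsub>K\<^esub> f \<in> weq) \<and> (f \<in> weq \<and> g \<cdot>\<^bsub>K\<^esub> f \<in> weq \<longrightarrow> g \<in> weq) \<and>
      (g \<in> weq \<and> g \<cdot>\<^bsub>K\<^esub> f \<in> weq \<longrightarrow> f \<in> weq)"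
    using equivalence_comp[OF F G] equivalence_cancel_right[OF F G] equivalence_cancel_left[OF F G] f g gf
    by (simp add: weq_def)
qed

lemma factorises_trivial_cof_fib: "factorises K (cof \<inter> weq) fib"
  unfolding factorises_def
proof
  fix f assume "f \<in> Arr K"
  then obtain A B where AB: "A \<in> S" "B \<in> S" and F: "f \<in> functors A B" using Arr_KE by blast
  obtain P i p where P: "P \<in> S" and i: "i \<in> functors A P" "injective_on_objects i"
      "equivalence_of_categories i" and p: "p \<in> functors P B" "isofibration p" and fact: "p \<circ>\<^sub>F i = f"
    using factor_trivial_cofibration_fibration[OF AB F] .
  have "i \<in> cof \<inter> weq" unfolding trivial_cof_iff using i Arr_KI[OF AB(1) P] by blast
  moreover have "p \<in> fib" unfolding fib_iff using p Arr_KI[OF P AB(2)] by blast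
  moreover have "FCod i = FDom p" by (simp add: functorsD(2)[OF i(1)] functorsD(1)[OF p(1)])
  ultimately show "\<exists>i \<in> cof \<inter> weq. \<exists>p \<in> fib. Tgt K i = Src K p \<and> f = p \<cdot>\<^bsub>K\<^esub> i"
    unfolding K_simps using fact by blast
qed

lemma factorises_cof_trivial_fib: "factorises K cof (fib \<inter> weq)"
  unfolding factorises_def
proof
  fix f assume "f \<in> Arr K"
  then obtain A B where AB: "A \<in> S" "B \<in> S" and F: "f \<in> functors A B" using Arr_KE by blast
  obtain C i p where C: "C \<in> S" and i: "i \<in> functors A C" "injective_on_objects i"
      and p: "p \<in> functors C B" "fully_faithful p" "surjective_on_objects p" and fact: "p \<circ>\<^sub>F i = f"
    using factor_cofibration_trivial_fibration[OF AB F] .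
  have "i \<in> cof" unfolding cof_iff using i Arr_KI[OF AB(1) C] by blast
  moreover have "p \<in> fib \<inter> weq" unfolding trivial_fib_iff using p Arr_KI[OF C AB(2)] by blast
  moreover have "FCod i = FDom p" by (simp add: functorsD(2)[OF i(1)] functorsD(1)[OF p(1)])
  ultimately show "\<exists>i \<in> cof. \<exists>p \<in> fib \<inter> weq. Tgt K i = Src K p \<and> f = p \<cdot>\<^bsub>K\<^esub> i"
    unfolding K_simps using fact by blast
qed

theorem model_structure_K: "model_structure K weq fib cof"
  unfolding model_structure_def
proof (intro conjI)
  show "weq \<subseteq> Arr K" "fib \<subseteq> Arr K" "cof \<subseteq> Arr K"
    by (auto simp: weq_def fib_def cof_def)
qed (rule category_K two_out_of_three_K fib_eq_rlp trivial_fib_eq_rlp cof_eq_llp trivial_cof_eq_llp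
    factorises_trivial_cof_fib factorises_cof_trivial_fib)+

end

theorem mainTheorem6:
  fixes \<kappa> :: "'k set"
    and K :: "(('u, 'u) cat, ('u, 'u, 'u, 'u) cfunctor) cat"
  assumes "infinite (UNIV :: 'u set)" and "infinite \<kappa>"
    and "K = Cat \<kappa> \<or> K = Grpd \<kappa>"
  shows "model_structure K
    {F \<in> Arr K. equivalence_of_categories F}
    {F \<in> Arr K. normally_cloven_isofibration F}
    {F \<in> Arr K. iso_cofibration K F}"
proof -
  obtain S :: "('u, 'u) cat set" where K: "K = category_of_categories S"
    and S: "S = {A. category A \<and> small_cat \<kappa> A} \<or> S = {A. groupoid A \<and> small_cat \<kappa> A}"
    using assms(3) by (auto simp: Cat_def Grpd_def)
  interpret category_universe \<kappa> S
    using assms(1,2) S by unfold_locales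
  show ?thesis
    using model_structure_K by (simp only: K weq_def fib_def cof_def)
qed

end
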